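(* Let $H,U,A,B$ satisfy (H1)--(H4) (as stated in the context), let $\omega>0$, and let $\Lambda_\omega$, $C$, $\widetilde J$, $J$, $U(t)$ and $A_U$ be as defined in the context. The operator $A:D(A)\subset H\to H$ can be extended to a bounded operator $\widetilde A:H\to D(A^* )'$. The operator $$\widetilde A-BJB^*\Lambda_\omega^{-1}$$ coincides with $A_U$ (the generator of $U(t)$) on $D(A_U)=\Lambda_\omega D(A^* )$, i.e. $$\forall x_0\in D(A_U),\qquad (\widetilde A-BJB^*\Lambda_\omega^{-1})x_0=A_Ux_0\in H.$$
   Context: Spaces and pairings. $H$ (state space) and $U$ (control space) are Hilbert spaces with duals $H'$, $U'$; $L(X,Y)$ denotes bounded linear operators. $\widetilde J:H\to H'$ and $J:U'\to U$ are the canonical (Riesz) isomorphisms. In the complex case, duals consist of continuous antilinear functionals and pairings $\langle\cdot,\cdot\rangle$ are linear in the first and antilinear in the second argument, so that $\langle x,\widetilde J y\rangle_{H,H'}=(x,y)_H$ and $\langle Jx',y'\rangle_{U,U'}=(x',y')_{U'}$. Adjoints $^*$ are taken with respect to these duality pairings. Hypotheses. (H1) $A:D(A)\subset H\to H$ generates a strongly continuous group $e^{tA}$ on $H$. Then $A^*:D(A^* )\subset H'\to H'$ generates the strongly continuous group $e^{tA^*}=(e^{tA})^*$ on $H'$. $D(A^* )$ is a Hilbert space with norm $\|x\|_{D(A^* )}^2=\|x\|_{H'}^2+\|A^*x\|_{H'}^2$, and $H\subset D(A^* )'$ via $\langle x,y\rangle_{D(A^* )',D(A^* )}=\langle x,y\rangle_{H,H'}$.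 (H2) $B\in L(U,D(A^* )')$; $B^*\in L(D(A^* ),U')$ denotes its adjoint (identifying $D(A^* )''$ with $D(A^* )$), so $\langle Bu,y\rangle_{D(A^* )',D(A^* )}=\langle u,B^*y\rangle_{U,U'}$. (H3) For every $T>0$ there is $c_1(T)>0$ with $\int_0^T\|B^*e^{-tA^*}x\|_{U'}^2dt\le c_1(T)\|x\|_{H'}^2$ for all $x\in D(A^* )$. By density, $t\mapsto B^*e^{-tA^*}x$ is then defined as an element of $L^2_{\rm loc}(\mathbb{R};U')$ for every $x\in H'$. (H4) There are $T>0$ and $c_2(T)>0$ with $c_2(T)\|x\|_{H'}^2\le\int_0^T\|B^*e^{-tA^*}x\|_{U'}^2dt$ for all $x\in D(A^* )$. This $T$ is fixed from now on. Weighted Gramian. Fix $\omega>0$, set $T_\omega:=T+\frac1{2\omega}$, and let $e_\omega(s)=e^{-2\omega s}$ for $0\le s\le T$, $e_\omega(s)=2\omega e^{-2\omega T}(T_\omega-s)$ for $T\le s\le T_\omega$. The operator $\Lambda_\omega\in L(H',H)$ is defined by $$\langle\Lambda_\omega x,y\rangle_{H,H'}=\int_0^{T_\omega}e_\omega(s)\langle JB^*e^{-sA^*}x,B^*e^{-sA^*}y\rangle_{U,U'}ds,\qquad x,y\in H'.$$ It is self-adjoint, positive-definite and invertible, with $\Lambda_\omega^{-1}\in L(H,H')$. The operator $C$. Let $L\in L(H)$ be the positive-definite self-adjoint operator given by $$(Lx,y)_H=-\int_0^{T_\omega}e_\omega'(s)\langle JB^*e^{-sA^*}\Lambda_\omega^{-1}x,B^*e^{-sA^*}\Lambda_\omega^{-1}y\rangle_{U,U'}ds,$$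 and $C:=\sqrt L\in L(H)$, with adjoint $C^*\in L(H')$, i.e. $\langle Cx,y\rangle_{H,H'}=\langle x,C^*y\rangle_{H,H'}$. Groups. $V(t)$ is the strongly continuous group on $H'$ generated by $-A^*-C^*\widetilde JC\Lambda_\omega$ with domain $D(A^* )$ (a bounded perturbation of $-A^*$). For $x_0\in H$, $U(t)x_0:=\Lambda_\omega V(t)\Lambda_\omega^{-1}x_0$ (the group $U(t)$ on $H$ is not to be confused with the control space $U$). It is a strongly continuous group on $H$ with generator $A_U=\Lambda_\omega(-A^*-C^*\widetilde JC\Lambda_\omega)\Lambda_\omega^{-1}$, $D(A_U)=\Lambda_\omega D(A^* )$. *)

theory Defs
  imports "HOL-Analysis.Analysis"
begin

text \<open>Every commutative real normed field is \<open>\<real>\<close> or \<open>\<complex>\<close> (Gelfand--Mazur), and the identity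
  \<open>a * kconj a = \<bar>a\<bar>\<^sup>2\<close> forces \<open>kconj\<close> to be the usual conjugation. The class therefore has exactly
  the real and the complex case as models and serves to treat both at once.\<close>

class real_or_complex = real_normed_field + banach + second_countable_topology +
  fixes kconj :: "'a \<Rightarrow> 'a" and kRe :: "'a \<Rightarrow> real"
  assumes kconj_add: "kconj (a + b) = kconj a + kconj b"
    and kconj_mult: "kconj (a * b) = kconj a * kconj b"
    and kconj_kconj: "kconj (kconj a) = a"
    and mult_kconj: "a * kconj a = ((norm a)\<^sup>2) *\<^sub>R 1"
    and kRe_scaleR_one: "kRe a *\<^sub>R 1 = (1 / 2) *\<^sub>R (a + kconj a)"

instantiation real :: real_or_complex
begin
definition kconj_real :: "real \<Rightarrow> real" where "kconj_real a = a"
definition kRe_real :: "real \<Rightarrow> real" where "kRe_real a = a"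
instance
  by standard (auto simp: kconj_real_def kRe_real_def power2_eq_square)
end

instantiation complex :: real_or_complex
begin
definition kconj_complex :: "complex \<Rightarrow> complex" where "kconj_complex = cnj"
definition kRe_complex :: "complex \<Rightarrow> real" where "kRe_complex = Re"
instance
proof
  fix a :: complex
  show "a * kconj a = ((norm a)\<^sup>2) *\<^sub>R 1"
    by (simp add: kconj_complex_def scaleR_conv_of_real flip: complex_norm_square)
  show "kRe a *\<^sub>R 1 = (1 / 2) *\<^sub>R (a + kconj a)"
    by (simp add: kRe_complex_def kconj_complex_def complex_add_cnj scaleR_conv_of_real)
qed (simp_all add: kconj_complex_def)
end

text \<open>A Hilbert space over \<open>'k\<close> is a complete real inner product space with a scalar multiplication
  by \<open>'k\<close> and a \<open>'k\<close>-valued inner product, linear in the first argument, whose real part is the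
  given real inner product; the norm is thus that of the type.\<close>

definition hilbert_space ::
  "('k::real_or_complex \<Rightarrow> 'x::{real_inner,banach} \<Rightarrow> 'x) \<Rightarrow> ('x \<Rightarrow> 'x \<Rightarrow> 'k) \<Rightarrow> bool" where
  "hilbert_space s p \<longleftrightarrow>
     vector_space s \<and>
     (\<forall>r x. s (of_real r) x = r *\<^sub>R x) \<and>
     (\<forall>x y z. p (x + y) z = p x z + p y z) \<and>
     (\<forall>a x y. p (s a x) y = a * p x y) \<and>
     (\<forall>x y. p y x = kconj (p x y)) \<and>
     (\<forall>x y. kRe (p x y) = x \<bullet> y)"

text \<open>Continuous antilinear functionals on a subspace \<open>D\<close> normed by \<open>nrm\<close>. They are extended
  by \<open>0\<close> outside \<open>D\<close>, so that equality of functionals is equality of functions.\<close>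

definition antidual ::
  "('k::real_or_complex \<Rightarrow> 'x::real_vector \<Rightarrow> 'x) \<Rightarrow> 'x set \<Rightarrow> ('x \<Rightarrow> real) \<Rightarrow> ('x \<Rightarrow> 'k) set" where
  "antidual s D nrm = {f.
     (\<forall>x\<in>D. \<forall>y\<in>D. f (x + y) = f x + f y) \<and>
     (\<forall>a. \<forall>x\<in>D. f (s a x) = kconj a * f x) \<and>
     (\<exists>K. \<forall>x\<in>D. norm (f x) \<le> K * nrm x) \<and>
     (\<forall>x. x \<notin> D \<longrightarrow> f x = 0)}"

definition antidual_norm ::
  "'x set \<Rightarrow> ('x \<Rightarrow> real) \<Rightarrow> ('x \<Rightarrow> 'k::real_normed_vector) \<Rightarrow> real" where
  "antidual_norm D nrm f = (SUP x\<in>{x\<in>D. nrm x \<le> 1}. norm (f x))"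

text \<open>A Hilbert space \<open>X\<close> (type \<open>'x\<close>) together with its dual \<open>X'\<close> (type \<open>'xd\<close>);
  \<open>pairing x x'\<close> is \<open>\<langle>x,x'\<rangle>\<close> in \<open>X, X'\<close>.\<close>

record ('k, 'x, 'xd) dual_pair =
  scl :: "'k \<Rightarrow> 'x \<Rightarrow> 'x"
  ip :: "'x \<Rightarrow> 'x \<Rightarrow> 'k"
  scl' :: "'k \<Rightarrow> 'xd \<Rightarrow> 'xd"
  ip' :: "'xd \<Rightarrow> 'xd \<Rightarrow> 'k"
  pairing :: "'x \<Rightarrow> 'xd \<Rightarrow> 'k"

text \<open>The last four conjuncts say that \<open>x' \<mapsto> (x \<mapsto> \<langle>x',x\<rangle>)\<close>, with \<open>\<langle>x',x\<rangle> = kconj \<langle>x,x'\<rangle>\<close>, is an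
  isometric linear isomorphism of the type \<open>'xd\<close> onto the space of all continuous antilinear
  functionals on \<open>X\<close>.\<close>

definition hilbert_dual_pair ::
  "('k::real_or_complex, 'x::{real_inner,banach}, 'xd::{real_inner,banach}) dual_pair \<Rightarrow> bool" where
  "hilbert_dual_pair X \<longleftrightarrow>
     hilbert_space (scl X) (ip X) \<and>
     hilbert_space (scl' X) (ip' X) \<and>
     (\<forall>x y z. pairing X x (y + z) = pairing X x y + pairing X x z) \<and>
     (\<forall>a x y. pairing X x (scl' X a y) = kconj a * pairing X x y) \<and>
     bij_betw (\<lambda>y x. kconj (pairing X x y)) UNIV (antidual (scl X) UNIV norm) \<and>
     (\<forall>y. norm y = antidual_norm UNIV norm (\<lambda>x. kconj (pairing X x y)))"

text \<open>The canonical isomorphisms \<open>X \<rightarrow> X'\<close> (for the state space this is \<open>J\<close> with tilde)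
  and \<open>X' \<rightarrow> X\<close> (for the control space this is \<open>J\<close>).\<close>

definition riesz :: "('k, 'x, 'xd) dual_pair \<Rightarrow> 'x \<Rightarrow> 'xd" where
  "riesz X y = (THE y'. \<forall>x. pairing X x y' = ip X x y)"

definition riesz' :: "('k, 'x, 'xd) dual_pair \<Rightarrow> 'xd \<Rightarrow> 'x" where
  "riesz' X x' = (THE x. \<forall>y'. pairing X x y' = ip' X x' y')"

definition bounded_op ::
  "('k \<Rightarrow> 'x::real_normed_vector \<Rightarrow> 'x) \<Rightarrow> ('k \<Rightarrow> 'y::real_normed_vector \<Rightarrow> 'y) \<Rightarrow> ('x \<Rightarrow> 'y) \<Rightarrow> bool"
  where
  "bounded_op s1 s2 F \<longleftrightarrow> bounded_linear F \<and> (\<forall>a x. F (s1 a x) = s2 a (F x))"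

definition bounded_op_antidual ::
  "('k::real_or_complex \<Rightarrow> 'x::real_normed_vector \<Rightarrow> 'x) \<Rightarrow> ('k \<Rightarrow> 'y::real_vector \<Rightarrow> 'y) \<Rightarrow> 'y set \<Rightarrow> ('y \<Rightarrow> real)
    \<Rightarrow> ('x \<Rightarrow> 'y \<Rightarrow> 'k) \<Rightarrow> bool" where
  "bounded_op_antidual s1 s2 D nrm F \<longleftrightarrow>
     (\<forall>x. F x \<in> antidual s2 D nrm) \<and>
     (\<forall>x y. F (x + y) = (\<lambda>v. F x v + F y v)) \<and>
     (\<forall>a x. F (s1 a x) = (\<lambda>v. a * F x v)) \<and>
     (\<exists>K. \<forall>x. antidual_norm D nrm (F x) \<le> K * norm x)"

text \<open>The adjoint \<open>Y' \<rightarrow> X'\<close> of an operator \<open>F : X \<rightarrow> Y\<close> with respect to the pairings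
  \<open>p1\<close> of \<open>X, X'\<close> and \<open>p2\<close> of \<open>Y, Y'\<close>.\<close>

definition adj :: "('x \<Rightarrow> 'xd \<Rightarrow> 'k) \<Rightarrow> ('y \<Rightarrow> 'yd \<Rightarrow> 'k) \<Rightarrow> ('x \<Rightarrow> 'y) \<Rightarrow> 'yd \<Rightarrow> 'xd" where
  "adj p1 p2 F y' = (THE x'. \<forall>x. p2 (F x) y' = p1 x x')"

definition is_positive_sqrt ::
  "('k::real_or_complex, 'x::real_normed_vector, 'xd) dual_pair \<Rightarrow> ('x \<Rightarrow> 'x) \<Rightarrow> ('x \<Rightarrow> 'x) \<Rightarrow> bool"
  where
  "is_positive_sqrt X F R \<longleftrightarrow>
     bounded_op (scl X) (scl X) R \<and>
     (\<forall>x y. ip X (R x) y = ip X x (R y)) \<and>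
     (\<forall>x. 0 \<le> kRe (ip X (R x) x)) \<and>
     R \<circ> R = F"

definition c0_group ::
  "('k \<Rightarrow> 'x::real_normed_vector \<Rightarrow> 'x) \<Rightarrow> (real \<Rightarrow> 'x \<Rightarrow> 'x) \<Rightarrow> bool" where
  "c0_group s S \<longleftrightarrow>
     (\<forall>t. bounded_op s s (S t)) \<and>
     S 0 = id \<and>
     (\<forall>t r. S (t + r) = S t \<circ> S r) \<and>
     (\<forall>x. continuous_on UNIV (\<lambda>t. S t x))"

definition gen_dom :: "(real \<Rightarrow> 'x::real_normed_vector \<Rightarrow> 'x) \<Rightarrow> 'x set" where
  "gen_dom S = {x. \<exists>y. ((\<lambda>t. (1 / t) *\<^sub>R (S t x - x)) \<longlongrightarrow> y) (at 0)}"

definition gen :: "(real \<Rightarrow> 'x::real_normed_vector \<Rightarrow> 'x) \<Rightarrow> 'x \<Rightarrow> 'x" where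
  "gen S x = Lim (at 0) (\<lambda>t. (1 / t) *\<^sub>R (S t x - x))"

definition generates ::
  "'x set \<Rightarrow> ('x \<Rightarrow> 'x) \<Rightarrow> (real \<Rightarrow> 'x::real_normed_vector \<Rightarrow> 'x) \<Rightarrow> bool" where
  "generates D G S \<longleftrightarrow> D = gen_dom S \<and> (\<forall>x\<in>D. G x = gen S x)"

text \<open>\<open>expA t\<close> is \<open>e\<^sup>t\<^sup>A\<close>; the values of \<open>opA\<close> outside \<open>domA\<close> are irrelevant. The control operator
  \<open>opB\<close> takes values in \<open>D(A\<^sup>*)'\<close>, represented by functions on \<open>H'\<close> that vanish outside \<open>D(A\<^sup>*)\<close>.\<close>

record ('k, 'h, 'hd, 'u, 'ud) control_system =
  state :: "('k, 'h, 'hd) dual_pair"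
  control :: "('k, 'u, 'ud) dual_pair"
  domA :: "'h set"
  opA :: "'h \<Rightarrow> 'h"
  expA :: "real \<Rightarrow> 'h \<Rightarrow> 'h"
  opB :: "'u \<Rightarrow> 'hd \<Rightarrow> 'k"

definition domAst :: "('k, 'h, 'hd, 'u, 'ud) control_system \<Rightarrow> 'hd set" where
  "domAst \<S> = {y. \<exists>z. \<forall>x\<in>domA \<S>. pairing (state \<S>) (opA \<S> x) y = pairing (state \<S>) x z}"

definition opAst :: "('k, 'h, 'hd, 'u, 'ud) control_system \<Rightarrow> 'hd \<Rightarrow> 'hd" where
  "opAst \<S> y = (THE z. \<forall>x\<in>domA \<S>. pairing (state \<S>) (opA \<S> x) y = pairing (state \<S>) x z)"

definition graph_norm ::
  "('k, 'h, 'hd::real_normed_vector, 'u, 'ud) control_system \<Rightarrow> 'hd \<Rightarrow> real" where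
  "graph_norm \<S> y = sqrt ((norm y)\<^sup>2 + (norm (opAst \<S> y))\<^sup>2)"

definition expAst :: "('k, 'h, 'hd, 'u, 'ud) control_system \<Rightarrow> real \<Rightarrow> 'hd \<Rightarrow> 'hd" where
  "expAst \<S> t = adj (pairing (state \<S>)) (pairing (state \<S>)) (expA \<S> t)"

text \<open>\<open>opBst\<close> is meaningful on \<open>D(A\<^sup>*)\<close> only; the pairing of \<open>D(A\<^sup>*)'\<close> and \<open>D(A\<^sup>*)\<close> is evaluation.\<close>

definition opBst :: "('k, 'h, 'hd, 'u, 'ud) control_system \<Rightarrow> 'hd \<Rightarrow> 'ud" where
  "opBst \<S> = adj (pairing (control \<S>)) (\<lambda>\<phi> y. \<phi> y) (opB \<S>)"

text \<open>The inclusion \<open>H \<subseteq> D(A\<^sup>*)'\<close>.\<close>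

definition embedH :: "('k::zero, 'h, 'hd, 'u, 'ud) control_system \<Rightarrow> 'h \<Rightarrow> 'hd \<Rightarrow> 'k" where
  "embedH \<S> x = (\<lambda>y. if y \<in> domAst \<S> then pairing (state \<S>) x y else 0)"

text \<open>\<open>is_observation \<S> x f\<close>: \<open>f\<close> represents the element \<open>t \<mapsto> B\<^sup>* e\<^sup>-\<^sup>t\<^sup>A\<^sup>* x\<close> of \<open>L\<^sup>2\<^sub>l\<^sub>o\<^sub>c(\<real>; U')\<close>
  obtained by density from \<open>D(A\<^sup>*)\<close>. Being a limit of continuous functions, such an \<open>f\<close> is
  almost everywhere separably valued, so Borel measurability suffices also if \<open>U'\<close> is not separable.
  It is unique up to null sets, and \<open>observation\<close> picks a representative.\<close>

definition is_observation ::
  "('k, 'h, 'hd::real_normed_vector, 'u, 'ud::real_normed_vector) control_system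
    \<Rightarrow> 'hd \<Rightarrow> (real \<Rightarrow> 'ud) \<Rightarrow> bool" where
  "is_observation \<S> x f \<longleftrightarrow>
     f \<in> borel_measurable lebesgue \<and>
     (\<forall>r>0. (\<integral>\<^sup>+t\<in>{-r..r}. ennreal ((norm (f t))\<^sup>2) \<partial>lebesgue) < \<infinity>) \<and>
     (\<forall>X. (\<forall>n. X n \<in> domAst \<S>) \<and> X \<longlonglongrightarrow> x \<longrightarrow>
       (\<forall>r>0. (\<lambda>n. \<integral>\<^sup>+t\<in>{-r..r}. ennreal ((norm (opBst \<S> (expAst \<S> (- t) (X n)) - f t))\<^sup>2) \<partial>lebesgue)
          \<longlonglongrightarrow> 0))"

definition observation ::
  "('k, 'h, 'hd::real_normed_vector, 'u, 'ud::real_normed_vector) control_system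
    \<Rightarrow> 'hd \<Rightarrow> real \<Rightarrow> 'ud" where
  "observation \<S> x = (SOME f. is_observation \<S> x f)"

text \<open>The formulas for \<open>e\<^sub>\<omega>\<close> extend to a \<open>C\<^sup>1\<close> function on \<open>\<real>\<close>, so that \<open>deriv\<close> yields \<open>e\<^sub>\<omega>'\<close>
  on all of \<open>[0, T\<^sub>\<omega>]\<close>.\<close>

definition weight :: "real \<Rightarrow> real \<Rightarrow> real \<Rightarrow> real" where
  "weight \<omega> T s =
     (if s \<le> T then exp (- 2 * \<omega> * s)
      else 2 * \<omega> * exp (- 2 * \<omega> * T) * (T + 1 / (2 * \<omega>) - s))"

definition gramian ::
  "('k::real_or_complex, 'h, 'hd::real_normed_vector, 'u, 'ud::real_normed_vector) control_system
    \<Rightarrow> real \<Rightarrow> real \<Rightarrow> 'hd \<Rightarrow> 'h" where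
  "gramian \<S> \<omega> T x = (THE h. \<forall>y. pairing (state \<S>) h y =
     (LINT s:{0..T + 1 / (2 * \<omega>)}|lebesgue.
        weight \<omega> T s *\<^sub>R
          pairing (control \<S>) (riesz' (control \<S>) (observation \<S> x s)) (observation \<S> y s)))"

definition opL ::
  "('k::real_or_complex, 'h, 'hd::real_normed_vector, 'u, 'ud::real_normed_vector) control_system
    \<Rightarrow> real \<Rightarrow> real \<Rightarrow> 'h \<Rightarrow> 'h" where
  "opL \<S> \<omega> T x = (THE z. \<forall>y. ip (state \<S>) z y =
     - (LINT s:{0..T + 1 / (2 * \<omega>)}|lebesgue.
        deriv (weight \<omega> T) s *\<^sub>R
          pairing (control \<S>)
            (riesz' (control \<S>) (observation \<S> (inv (gramian \<S> \<omega> T) x) s))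
            (observation \<S> (inv (gramian \<S> \<omega> T) y) s)))"

text \<open>The operator \<open>-A\<^sup>* - C\<^sup>* J C \<Lambda>\<^sub>\<omega>\<close> (with \<open>J : H \<rightarrow> H'\<close> the Riesz map).\<close>

definition gen_V ::
  "('k::real_or_complex, 'h, 'hd::real_normed_vector, 'u, 'ud::real_normed_vector) control_system
    \<Rightarrow> real \<Rightarrow> real \<Rightarrow> ('h \<Rightarrow> 'h) \<Rightarrow> 'hd \<Rightarrow> 'hd" where
  "gen_V \<S> \<omega> T C y =
     - opAst \<S> y
     - adj (pairing (state \<S>)) (pairing (state \<S>)) C (riesz (state \<S>) (C (gramian \<S> \<omega> T y)))"

definition group_U ::
  "('k::real_or_complex, 'h, 'hd::real_normed_vector, 'u, 'ud::real_normed_vector) control_system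
    \<Rightarrow> real \<Rightarrow> real \<Rightarrow> (real \<Rightarrow> 'hd \<Rightarrow> 'hd) \<Rightarrow> real \<Rightarrow> 'h \<Rightarrow> 'h" where
  "group_U \<S> \<omega> T V t x = gramian \<S> \<omega> T (V t (inv (gramian \<S> \<omega> T) x))"

definition bounded_extension_A ::
  "('k::real_or_complex, 'h::real_normed_vector, 'hd::real_normed_vector, 'u, 'ud) control_system
    \<Rightarrow> ('h \<Rightarrow> 'hd \<Rightarrow> 'k) \<Rightarrow> bool" where
  "bounded_extension_A \<S> At \<longleftrightarrow>
     bounded_op_antidual (scl (state \<S>)) (scl' (state \<S>)) (domAst \<S>) (graph_norm \<S>) At \<and>
     (\<forall>x\<in>domA \<S>. At x = embedH \<S> (opA \<S> x))"

end

theory Submission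
  imports Defs
begin

text \<open>Write \<open>\<Lambda>\<close> for the weighted Gramian, \<open>a\<close> for the sesquilinear form on \<open>H'\<close> that defines it and
  \<open>a'\<close> for the same form with the weight replaced by its derivative. The whole theorem rests on one
  identity on \<open>D(A\<^sup>*)\<close>,
  \<open>a(A\<^sup>*y, z) + a(y, A\<^sup>*z) = (B\<^sup>*y, B\<^sup>*z) + a'(y, z)\<close>,
  an algebraic Lyapunov equation for \<open>\<Lambda>\<close> (lemma \<open>obs_form_lyapunov\<close>). It comes from
  integrating the weight against a derivative: applying \<open>e\<^sup>-\<^sup>h\<^sup>A\<^sup>*\<close> to both arguments of \<open>a\<close> translates
  the observations \<open>t \<mapsto> B\<^sup>*e\<^sup>-\<^sup>t\<^sup>A\<^sup>*y\<close> by \<open>h\<close>, and the weight falls from \<open>1\<close> at time \<open>0\<close> to \<open>0\<close> at the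
  final time, so that exactly one boundary term survives.

  The identity is the theorem in disguise. Since \<open>C\<^sup>2 = L\<close> and \<open>L\<close> is \<open>-a'\<close> transported by
  \<open>\<Lambda>\<^sup>-\<^sup>1\<close>, the feedback term \<open>C\<^sup>*JC\<Lambda>\<close> in the generator of \<open>V\<close> represents \<open>-a'\<close> (lemma
  \<open>pairing_feedback\<close>). Hence
  \<open>\<langle>\<Lambda>(-A\<^sup>* - C\<^sup>*JC\<Lambda>)y, z\<rangle> = -a(A\<^sup>*y, z) + a'(y, z) = a(y, A\<^sup>*z) - (B\<^sup>*y, B\<^sup>*z)\<close>,
  and the right-hand side is the extension of \<open>A\<close> at \<open>\<Lambda>y\<close> minus \<open>BJB\<^sup>*y\<close>, evaluated at \<open>z\<close> (lemma
  \<open>pairing_gramian_gen_V\<close>). The extension of \<open>A\<close> is \<open>x \<mapsto> \<langle>x, A\<^sup>* \<cdot>\<rangle>\<close>, and it is the only one because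
  \<open>D(A)\<close> is dense. The generator of \<open>\<Lambda>V(t)\<Lambda>\<^sup>-\<^sup>1\<close> is the conjugated generator of \<open>V\<close> because \<open>\<Lambda>\<close> is a
  linear homeomorphism (lemma \<open>conjugate_generator\<close>).

  Most of the work consists in giving a meaning to these objects. Riesz's theorem provides the
  duality maps, the adjoints and \<open>\<Lambda>\<close>; the Lax--Milgram lemma \<open>coercive_surj\<close> makes \<open>\<Lambda>\<close> bijective.
  Orbits of the adjoint group are strongly continuous, and differentiable on \<open>D(A\<^sup>*)\<close>, by duality with
  orbits in \<open>D(A)\<close>, where the uniform boundedness principle supplies local bounds. Finally, the
  observation of an arbitrary state exists and is unique almost everywhere by Fatou's lemma and the
  Riesz--Fischer argument (lemmas \<open>is_observation_if_limit\<close>, \<open>outp_AE_convergent_sequence\<close>,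
  \<open>is_observation_unique\<close>); \<open>U'\<close> may be non-separable, so this is carried out with almost everywhere
  limits of continuous functions.\<close>

section \<open>Scalars\<close>

lemma norm_kconj [simp]: "norm (kconj a) = norm (a::'k::real_or_complex)"
proof (cases "a = 0")
  case False
  have "norm a * norm (kconj a) = (norm a)\<^sup>2"
    using arg_cong[OF mult_kconj[of a], of norm] by (simp add: norm_mult)
  with False show ?thesis
    by (simp add: power2_eq_square)
next
  case True
  have "kconj (0::'k) = 0"
    using kconj_add[of "0::'k" 0] by simp
  with True show ?thesis
    by simp
qed

lemma kconj_0 [simp]: "kconj (0::'k::real_or_complex) = 0"
  using norm_kconj[of "0::'k"] by (simp del: norm_kconj)

lemma kconj_of_real [simp]: "kconj (of_real r) = (of_real r :: 'k::real_or_complex)"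
proof (cases "r = 0")
  case False
  have "of_real r * kconj (of_real r) = of_real r * (of_real r :: 'k)"
    by (simp add: mult_kconj scaleR_conv_of_real power2_eq_square)
  with False show ?thesis
    by simp
qed simp

lemma bounded_linear_kconj: "bounded_linear (kconj :: 'k::real_or_complex \<Rightarrow> 'k)"
  by (rule bounded_linear_intro[where K = 1])
    (simp_all add: kconj_add scaleR_conv_of_real kconj_mult)

lemma of_real_kRe: "of_real (kRe a) = (1 / 2) *\<^sub>R (a + kconj (a::'k::real_or_complex))"
  using kRe_scaleR_one[of a] by (simp add: scaleR_conv_of_real)

lemma bounded_linear_kRe: "bounded_linear (kRe :: 'k::real_or_complex \<Rightarrow> real)"
proof (rule bounded_linear_intro[where K = 1])
  fix a b :: 'k and r :: real
  have "of_real (kRe (a + b)) = (of_real (kRe a + kRe b) :: 'k)"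
    by (simp add: of_real_kRe kconj_add algebra_simps)
  then show "kRe (a + b) = kRe a + kRe b"
    using of_real_eq_iff by blast
  have "of_real (kRe (r *\<^sub>R a)) = (of_real (r *\<^sub>R kRe a) :: 'k)"
    by (simp add: of_real_kRe scaleR_conv_of_real kconj_mult algebra_simps)
  then show "kRe (r *\<^sub>R a) = r *\<^sub>R kRe a"
    using of_real_eq_iff by blast
  have "norm (of_real (kRe a) :: 'k) \<le> (1 / 2) * (norm a + norm (kconj a))"
    unfolding of_real_kRe using norm_triangle_ineq[of a "kconj a"] by simp
  then show "norm (kRe a) \<le> norm a * 1"
    by simp
qed

lemma kRe_of_real [simp]: "kRe (of_real r :: 'k::real_or_complex) = r"
proof -
  have "of_real (kRe (of_real r :: 'k)) = (of_real r :: 'k)"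
    by (simp add: of_real_kRe flip: scaleR_2)
  then show ?thesis
    using of_real_eq_iff by blast
qed

lemma kRe_mult_kconj [simp]: "kRe (kconj a * a) = (norm (a::'k::real_or_complex))\<^sup>2"
  using mult_kconj[of a] by (simp add: mult.commute scaleR_conv_of_real flip: of_real_power)

lemma abs_kRe_le: "\<bar>kRe a\<bar> \<le> norm (a::'k::real_or_complex)"
proof -
  have "norm (of_real (kRe a) :: 'k) \<le> (1 / 2) * (norm a + norm (kconj a))"
    unfolding of_real_kRe using norm_triangle_ineq[of a "kconj a"] by simp
  then show ?thesis
    by simp
qed

text \<open>Real parts determine scalars as soon as all multiples are available. This
  reduces identities between scalars to real inner products and real integrals.\<close>

lemma eq_0_if_kRe_multiples:
  "(\<And>c. kRe (c * a) = 0) \<Longrightarrow> (a::'k::real_or_complex) = 0"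
  using kRe_mult_kconj[of a] by simp

lemma eq_if_kRe_multiples:
  assumes "\<And>c. kRe (c * a) = kRe (c * b)"
  shows "(a::'k::real_or_complex) = b"
proof -
  interpret kRe: bounded_linear "kRe :: 'k \<Rightarrow> real" by (rule bounded_linear_kRe)
  have "a - b = 0"
    by (rule eq_0_if_kRe_multiples) (simp add: right_diff_distrib kRe.diff assms)
  then show ?thesis by simp
qed

section \<open>Hilbert spaces\<close>

text \<open>Riesz's theorem by the variational method: \<open>x \<mapsto> \<parallel>x\<parallel>\<^sup>2 - 2 f x\<close> is bounded below, by the
  parallelogram law a minimising sequence is Cauchy, and at the minimum the first variation
  vanishes.\<close>

lemma real_riesz:
  fixes f :: "'x::{real_inner,banach} \<Rightarrow> real"
  assumes "bounded_linear f"
  obtains z where "\<And>x. f x = x \<bullet> z"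
proof -
  interpret f: bounded_linear f by fact
  define q where "q x = (norm x)\<^sup>2 - 2 * f x" for x
  obtain K where K: "\<And>x. norm (f x) \<le> norm x * K"
    using f.bounded by blast
  have q_ge: "- K\<^sup>2 \<le> q x" for x
  proof -
    have "f x \<le> norm x * K"
      using K[of x] by simp
    moreover have "0 \<le> (norm x - K)\<^sup>2"
      by simp
    ultimately show ?thesis
      unfolding q_def by (simp add: power2_diff)
  qed
  define m where "m = Inf (range q)"
  have bdd: "bdd_below (range q)"
    using q_ge by (auto intro!: bdd_belowI2)
  have m_le: "m \<le> q x" for x
    unfolding m_def using bdd by (intro cInf_lower) auto
  have "\<exists>x. q x < m + inverse (real (Suc n))" for n
    using cInf_lessD[of "range q" "m + inverse (real (Suc n))"] by (auto simp: m_def)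
  then obtain u where u: "\<And>n. q (u n) < m + inverse (real (Suc n))"
    by metis
  have mid: "(norm (x - y))\<^sup>2 \<le> 2 * (q x - m) + 2 * (q y - m)" for x y
  proof -
    have "(norm (x - y))\<^sup>2 = 2 * q x + 2 * q y - 4 * q ((1/2) *\<^sub>R (x + y))"
      unfolding q_def f.scaleR f.add
      by (simp add: power2_norm_eq_inner inner_add_left inner_add_right inner_diff_left
          inner_diff_right inner_commute[of y x] algebra_simps)
    with m_le[of "(1/2) *\<^sub>R (x + y)"] show ?thesis
      by simp
  qed
  have "Cauchy u"
  proof (rule metric_CauchyI)
    fix e :: real assume "0 < e"
    then obtain N where N: "inverse (real (Suc N)) < e\<^sup>2 / 4"
      using reals_Archimedean[of "e\<^sup>2 / 4"] by auto
    have "dist (u i) (u j) < e" if "i \<ge> N" "j \<ge> N" for i j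
    proof -
      have "q (u k) - m < e\<^sup>2 / 4" if "k \<ge> N" for k
      proof -
        have "inverse (real (Suc k)) \<le> inverse (real (Suc N))"
          using that by (intro le_imp_inverse_le) auto
        with u[of k] N show ?thesis by linarith
      qed
      from this[OF that(1)] this[OF that(2)] mid[of "u i" "u j"]
      have "(norm (u i - u j))\<^sup>2 < 2 * (e\<^sup>2 / 4) + 2 * (e\<^sup>2 / 4)"
        by (smt (verit))
      then have "(norm (u i - u j))\<^sup>2 < e\<^sup>2"
        by simp
      with \<open>0 < e\<close> show ?thesis
        by (simp add: dist_norm power_less_imp_less_base)
    qed
    then show "\<exists>N. \<forall>i\<ge>N. \<forall>j\<ge>N. dist (u i) (u j) < e"
      by blast
  qed
  then obtain z where z: "u \<longlonglongrightarrow> z"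
    using Cauchy_convergent_iff convergent_def by blast
  have "(\<lambda>n. q (u n)) \<longlonglongrightarrow> q z"
    unfolding q_def by (intro tendsto_intros f.tendsto z)
  moreover have "(\<lambda>n. m + inverse (real (Suc n))) \<longlonglongrightarrow> m + 0"
    by (intro tendsto_intros LIMSEQ_inverse_real_of_nat)
  ultimately have "q z \<le> m"
    using u by (auto intro: LIMSEQ_le less_imp_le)
  then have min: "q z \<le> q y" for y
    using m_le[of y] by linarith
  have "f x = x \<bullet> z" for x
  proof -
    define d where "d = x \<bullet> z - f x"
    have quad: "0 \<le> t\<^sup>2 * (norm x)\<^sup>2 + 2 * t * d" for t
      using min[of "z + t *\<^sub>R x"] unfolding q_def d_def f.scaleR f.add
      by (simp add: power2_norm_eq_inner inner_add_left inner_add_right inner_commute[of z x]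
          power2_eq_square[of t] algebra_simps)
    have "d = 0"
    proof (rule ccontr)
      assume "d \<noteq> 0"
      define N where "N = (norm x)\<^sup>2 + 1"
      have "N > 0" unfolding N_def by (simp add: add_nonneg_pos)
      have "(d / N)\<^sup>2 * (norm x)\<^sup>2 \<le> (d / N)\<^sup>2 * N"
        unfolding N_def by (intro mult_left_mono) auto
      also have "\<dots> = d\<^sup>2 / N"
        using \<open>N > 0\<close> by (simp add: power2_eq_square)
      finally have "0 \<le> d\<^sup>2 / N - 2 * (d\<^sup>2 / N)"
        using quad[of "- (d / N)"] by (simp add: power2_eq_square)
      moreover have "d\<^sup>2 / N > 0"
        using \<open>d \<noteq> 0\<close> \<open>N > 0\<close> by simp
      ultimately show False by linarith
    qed
    then show ?thesis
      unfolding d_def by simp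
  qed
  then show thesis
    by (rule that)
qed

locale hilbert =
  fixes s :: "'k::real_or_complex \<Rightarrow> 'x::{real_inner,banach} \<Rightarrow> 'x" and p :: "'x \<Rightarrow> 'x \<Rightarrow> 'k"
  assumes hilbert_space: "hilbert_space s p"
begin

lemma vector_space: "vector_space s"
  and scale_of_real: "s (of_real r) x = r *\<^sub>R x"
  and ip_add_left: "p (x + y) z = p x z + p y z"
  and ip_scale_left: "p (s a x) y = a * p x y"
  and ip_commute: "p y x = kconj (p x y)"
  and kRe_ip: "kRe (p x y) = x \<bullet> y"
  using hilbert_space unfolding hilbert_space_def by blast+

lemma scale_add: "s a (x + y) = s a x + s a y"
  and scale_scale: "s a (s b x) = s (a * b) x"
proof -
  interpret vector_space s by (rule vector_space)
  show "s a (x + y) = s a x + s a y" "s a (s b x) = s (a * b) x"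
    by (simp_all add: scale_right_distrib)
qed

lemma scale_scaleR: "s a (r *\<^sub>R x) = r *\<^sub>R s a x"
  by (simp flip: scale_of_real add: scale_scale mult.commute)

lemma ip_add_right: "p x (y + z) = p x y + p x z"
  by (metis ip_add_left ip_commute kconj_add)

lemma ip_scale_right: "p x (s a y) = kconj a * p x y"
  by (metis ip_commute ip_scale_left kconj_mult)

lemma norm_scale: "norm (s a x) = norm a * norm x"
proof -
  have "(norm (s a x))\<^sup>2 = kRe (kconj a * a * p x x)"
    by (simp add: power2_norm_eq_inner ip_scale_left ip_scale_right mult.assoc flip: kRe_ip)
  also have "kconj a * a * p x x = (norm a)\<^sup>2 *\<^sub>R p x x"
    using mult_kconj[of a] by (simp add: mult.commute scaleR_conv_of_real)
  also have "kRe \<dots> = (norm a * norm x)\<^sup>2"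
    by (simp add: linear_cmul[OF bounded_linear.linear[OF bounded_linear_kRe]] kRe_ip
        power2_norm_eq_inner power_mult_distrib)
  finally show ?thesis
    by (rule power2_eq_imp_eq) auto
qed

lemma bounded_linear_scale: "bounded_linear (s a)"
  by (rule bounded_linear_intro[where K = "norm a"])
    (simp_all add: scale_add scale_scaleR norm_scale)

lemma norm_ip_le: "norm (p x y) \<le> norm x * norm y"
proof (cases "p x y = 0")
  case False
  have "(norm (p x y))\<^sup>2 = s (kconj (p x y)) x \<bullet> y"
    by (simp add: ip_scale_left flip: kRe_ip)
  also have "\<dots> \<le> norm (s (kconj (p x y)) x) * norm y"
    by (rule norm_cauchy_schwarz)
  also have "\<dots> = norm (p x y) * (norm x * norm y)"
    by (simp add: norm_scale)
  finally show ?thesis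
    using False by (simp add: power2_eq_square)
qed simp

lemma ip_scaleR_left: "p (r *\<^sub>R x) y = r *\<^sub>R p x y"
  by (simp add: ip_scale_left scaleR_conv_of_real flip: scale_of_real)

lemma ip_scaleR_right: "p x (r *\<^sub>R y) = r *\<^sub>R p x y"
  by (simp add: ip_scale_right scaleR_conv_of_real flip: scale_of_real)

lemma bounded_bilinear_ip: "bounded_bilinear p"
proof
  show "\<exists>K. \<forall>a b. norm (p a b) \<le> norm a * norm b * K"
    using norm_ip_le by (auto intro!: exI[of _ 1])
qed (simp_all add: ip_add_left ip_add_right ip_scaleR_left ip_scaleR_right)

lemma ip_self: "p x x = of_real ((norm x)\<^sup>2)"
proof -
  have "of_real (kRe (p x x)) = (1 / 2) *\<^sub>R (p x x + p x x)"
    unfolding of_real_kRe by (simp flip: ip_commute)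
  then show ?thesis
    by (simp add: kRe_ip power2_norm_eq_inner flip: scaleR_2)
qed

lemma ip_ext: "(\<And>x. p x y = p x z) \<Longrightarrow> y = z"
proof -
  assume *: "\<And>x. p x y = p x z"
  have "x \<bullet> y = x \<bullet> z" for x
    using *[of x] by (simp flip: kRe_ip)
  then show "y = z"
    by (metis inner_commute vector_eq_ldot)
qed

lemma riesz_representation:
  assumes add: "\<And>x y. f (x + y) = f x + f y" and scale: "\<And>a x. f (s a x) = a * f x"
    and bound: "\<And>x. norm (f x) \<le> K * norm x"
  obtains z where "\<And>x. f x = p x z"
proof -
  have "bounded_linear f"
    by (rule bounded_linear_intro[where K = K])
      (use bound in \<open>simp_all add: add mult.commute scaleR_conv_of_real scale flip: scale_of_real\<close>)
  then have "bounded_linear (\<lambda>x. kRe (f x))"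
    by (rule bounded_linear_compose[OF bounded_linear_kRe])
  then obtain z where z: "\<And>x. kRe (f x) = x \<bullet> z"
    by (rule real_riesz) blast
  have "f x = p x z" for x
  proof (rule eq_if_kRe_multiples)
    fix c
    show "kRe (c * f x) = kRe (c * p x z)"
      using z[of "s c x"] by (simp add: scale ip_scale_left flip: kRe_ip)
  qed
  then show thesis
    by (rule that)
qed

lemma riesz_representation_antilinear:
  assumes add: "\<And>x y. f (x + y) = f x + f y" and scale: "\<And>a x. f (s a x) = kconj a * f x"
    and bound: "\<And>x. norm (f x) \<le> K * norm x"
  obtains z where "\<And>x. f x = p z x"
proof -
  obtain z where z: "\<And>x. kconj (f x) = p x z"
    by (rule riesz_representation[of "\<lambda>x. kconj (f x)" K])
      (use bound in \<open>simp_all add: add scale kconj_add kconj_mult kconj_kconj\<close>)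
  show thesis
    by (rule that[of z]) (metis z kconj_kconj ip_commute)
qed

end

section \<open>Dual pairs\<close>

text \<open>Scale \<open>x\<close> to the unit sphere of \<open>nrm\<close>. Boundedness of the functional is what makes the supremum
  in the definition of the norm an upper bound.\<close>

lemma norm_antidual_le:
  assumes f: "f \<in> antidual s D nrm" and x: "x \<in> D" and nrm: "\<And>x. x \<in> D \<Longrightarrow> nrm x \<ge> 0"
    and sc: "\<And>a. a > 0 \<Longrightarrow> s (of_real a) x \<in> D \<and> nrm (s (of_real a) x) = a * nrm x"
  shows "norm (f x) \<le> antidual_norm D nrm f * nrm x"
proof -
  obtain K where K: "\<And>x. x \<in> D \<Longrightarrow> norm (f x) \<le> K * nrm x"
    using f unfolding antidual_def by blast
  have bdd: "bdd_above ((\<lambda>x. norm (f x)) ` {x \<in> D. nrm x \<le> 1})"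
  proof (rule bdd_aboveI2)
    fix y assume y: "y \<in> {x \<in> D. nrm x \<le> 1}"
    have "K * nrm y \<le> \<bar>K\<bar> * 1"
      using nrm y by (intro mult_mono) auto
    then show "norm (f y) \<le> \<bar>K\<bar>"
      using K[of y] y by auto
  qed
  show ?thesis
  proof (cases "nrm x = 0")
    case True
    with K[OF x] show ?thesis by simp
  next
    case False
    define a where "a = 1 / nrm x"
    have a: "a > 0" using False nrm[OF x] by (simp add: a_def)
    have "norm (f (s (of_real a) x)) \<le> antidual_norm D nrm f"
      unfolding antidual_norm_def using sc[OF a] bdd False
      by (intro cSUP_upper) (auto simp: a_def)
    moreover have "norm (f (s (of_real a) x)) = a * norm (f x)"
      using f x a unfolding antidual_def by (simp add: norm_mult)
    ultimately have "a * norm (f x) \<le> antidual_norm D nrm f"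
      by simp
    then show ?thesis
      using False nrm[OF x] by (simp add: a_def field_simps)
  qed
qed

locale dual_pair_space =
  fixes X :: "('k::real_or_complex, 'x::{real_inner,banach}, 'xd::{real_inner,banach}) dual_pair"
  assumes hilbert_dual_pair: "hilbert_dual_pair X"
begin

sublocale primal: hilbert "scl X" "ip X"
  using hilbert_dual_pair by unfold_locales (simp add: hilbert_dual_pair_def)

sublocale dual: hilbert "scl' X" "ip' X"
  using hilbert_dual_pair by unfold_locales (simp add: hilbert_dual_pair_def)

lemma pairing_add_right: "pairing X x (y + z) = pairing X x y + pairing X x z"
  and pairing_scale_right: "pairing X x (scl' X a y) = kconj a * pairing X x y"
  and bij_dual: "bij_betw (\<lambda>y x. kconj (pairing X x y)) UNIV (antidual (scl X) UNIV norm)"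
  and norm_dual: "norm y = antidual_norm UNIV norm (\<lambda>x. kconj (pairing X x y))"
  using hilbert_dual_pair unfolding hilbert_dual_pair_def by auto

lemma functional_antidual: "(\<lambda>x. kconj (pairing X x y)) \<in> antidual (scl X) UNIV norm"
  using bij_dual unfolding bij_betw_def by blast

lemma pairing_add_left: "pairing X (x + y) z = pairing X x z + pairing X y z"
proof -
  have "kconj (pairing X (x + y) z) = kconj (pairing X x z) + kconj (pairing X y z)"
    using functional_antidual[of z] unfolding antidual_def by auto
  then show ?thesis
    by (metis kconj_add kconj_kconj)
qed

lemma pairing_scale_left: "pairing X (scl X a x) z = a * pairing X x z"
proof -
  have "kconj (pairing X (scl X a x) z) = kconj a * kconj (pairing X x z)"
    using functional_antidual[of z] unfolding antidual_def by auto
  then show ?thesis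
    by (metis kconj_mult kconj_kconj)
qed

lemma norm_pairing_le: "norm (pairing X x y) \<le> norm x * norm y"
  using norm_antidual_le[OF functional_antidual[of y], of x]
  by (simp add: primal.norm_scale flip: norm_dual) (simp add: mult.commute)

lemma pairing_scaleR_left: "pairing X (r *\<^sub>R x) y = r *\<^sub>R pairing X x y"
  by (simp add: pairing_scale_left scaleR_conv_of_real flip: primal.scale_of_real)

lemma pairing_scaleR_right: "pairing X x (r *\<^sub>R y) = r *\<^sub>R pairing X x y"
  by (simp add: pairing_scale_right scaleR_conv_of_real flip: dual.scale_of_real)

lemma bounded_bilinear_pairing: "bounded_bilinear (pairing X)"
proof
  show "\<exists>K. \<forall>a b. norm (pairing X a b) \<le> norm a * norm b * K"
    using norm_pairing_le by (auto intro!: exI[of _ 1])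
qed (simp_all add: pairing_add_left pairing_add_right pairing_scaleR_left pairing_scaleR_right)

sublocale pairing: bounded_bilinear "pairing X"
  by (rule bounded_bilinear_pairing)

lemma dual_ext: "(\<And>x. pairing X x y = pairing X x z) \<Longrightarrow> y = z"
  using bij_dual unfolding bij_betw_def inj_def by metis

lemma norm_dual_le:
  assumes "0 \<le> K" "\<And>x. norm (pairing X x y) \<le> K * norm x"
  shows "norm y \<le> K"
  unfolding norm_dual antidual_norm_def
proof (rule cSUP_least)
  show "{x \<in> UNIV. norm (x::'x) \<le> 1} \<noteq> {}"
    by (auto intro: exI[of _ 0])
  fix x :: 'x assume "x \<in> {x \<in> UNIV. norm x \<le> 1}"
  then have "K * norm x \<le> K"
    using \<open>0 \<le> K\<close> by (intro mult_left_le) auto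
  then show "norm (kconj (pairing X x y)) \<le> K"
    using assms(2)[of x] by simp
qed

text \<open>Every \<open>x \<mapsto> ip X x y\<close> is the conjugate of a continuous antilinear functional, and the dual
  space consists of all of them.\<close>

lemma riesz_ex1: "\<exists>!y'. \<forall>x. pairing X x y' = ip X x y"
proof -
  have "(\<lambda>x. kconj (ip X x y)) \<in> antidual (scl X) UNIV norm"
    unfolding antidual_def using primal.norm_ip_le[of _ y]
    by (auto simp: primal.ip_add_left primal.ip_scale_left kconj_add kconj_mult mult.commute
        intro!: exI[of _ "norm y"])
  then obtain y' where "(\<lambda>x. kconj (ip X x y)) = (\<lambda>x. kconj (pairing X x y'))"
    using bij_dual unfolding bij_betw_def by blast
  then have "pairing X x y' = ip X x y" for x
    by (metis kconj_kconj)
  then show ?thesis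
    using dual_ext by metis
qed

lemma pairing_riesz: "pairing X x (riesz X y) = ip X x y"
  unfolding riesz_def using theI'[OF riesz_ex1[of y]] by blast

lemma riesz_unique: "(\<And>x. pairing X x y' = ip X x y) \<Longrightarrow> riesz X y = y'"
  by (rule dual_ext) (simp add: pairing_riesz)

lemma riesz_add: "riesz X (x + y) = riesz X x + riesz X y"
  by (rule riesz_unique) (simp add: pairing_add_right pairing_riesz primal.ip_add_right)

lemma riesz_scale: "riesz X (scl X a x) = scl' X a (riesz X x)"
  by (rule riesz_unique) (simp add: pairing_scale_right pairing_riesz primal.ip_scale_right)

lemma riesz_scaleR: "riesz X (r *\<^sub>R x) = r *\<^sub>R riesz X x"
  by (metis riesz_scale primal.scale_of_real dual.scale_of_real)

lemma norm_riesz: "norm (riesz X y) = norm y"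
proof (rule antisym)
  show "norm (riesz X y) \<le> norm y"
    by (rule norm_dual_le) (use primal.norm_ip_le[of _ y] in \<open>auto simp: pairing_riesz mult.commute\<close>)
  have "norm y * norm y = norm (pairing X y (riesz X y))"
    by (simp add: norm_mult pairing_riesz primal.ip_self power2_eq_square)
  also have "\<dots> \<le> norm y * norm (riesz X y)"
    by (rule norm_pairing_le)
  finally show "norm y \<le> norm (riesz X y)"
    by (cases "norm y = 0") auto
qed

lemma bounded_linear_riesz: "bounded_linear (riesz X)"
  by (rule bounded_linear_intro[where K = 1]) (simp_all add: riesz_add riesz_scaleR norm_riesz)

text \<open>Riesz's theorem for the linear functional given by the pairing with \<open>y\<close>.\<close>

lemma riesz_surj: "\<exists>z. riesz X z = y"
proof -
  obtain z where "\<And>x. pairing X x y = ip X x z"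
    by (rule primal.riesz_representation[of "\<lambda>x. pairing X x y" "norm y"])
      (use norm_pairing_le[of _ y] in \<open>simp_all add: pairing_add_left pairing_scale_left mult.commute\<close>)
  then show ?thesis
    using riesz_unique by blast
qed

text \<open>By polarisation the isometry \<open>riesz X\<close> also preserves inner products; hence its inverse has
  the property that defines \<open>riesz' X\<close>.\<close>

lemma ip_riesz: "ip' X (riesz X x) (riesz X y) = ip X x y"
proof (rule eq_if_kRe_multiples)
  have real: "riesz X x \<bullet> riesz X y = x \<bullet> y" for x y
    by (simp add: norm_riesz dot_norm flip: riesz_add)
  fix c
  show "kRe (c * ip' X (riesz X x) (riesz X y)) = kRe (c * ip X x y)"
    using real[of "scl X c x" y]
    by (simp add: riesz_scale dual.ip_scale_left primal.ip_scale_left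
        flip: dual.kRe_ip primal.kRe_ip)
qed

lemma riesz'_riesz: "riesz' X (riesz X z) = z"
  unfolding riesz'_def
proof (rule the_equality)
  show *: "\<forall>y'. pairing X z y' = ip' X (riesz X z) y'"
    by (metis riesz_surj ip_riesz pairing_riesz)
  fix x assume "\<forall>y'. pairing X x y' = ip' X (riesz X z) y'"
  then have "ip X y x = ip X y z" for y
    by (metis * pairing_riesz primal.ip_commute)
  then show "x = z"
    by (rule primal.ip_ext)
qed

lemma pairing_riesz': "pairing X (riesz' X x) y = ip' X x y"
  by (metis riesz_surj riesz'_riesz ip_riesz pairing_riesz)

lemma primal_ext: "(\<And>y. pairing X x y = pairing X x' y) \<Longrightarrow> x = x'"
  by (metis pairing_riesz primal.ip_commute primal.ip_ext)

lemma norm_primal_le: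
  assumes "0 \<le> K" "\<And>y. norm (pairing X x y) \<le> K * norm y"
  shows "norm x \<le> K"
proof -
  have "norm x * norm x \<le> K * norm x"
    using assms(2)[of "riesz X x"]
    by (simp add: norm_mult pairing_riesz primal.ip_self power2_eq_square norm_riesz)
  then show ?thesis
    using \<open>0 \<le> K\<close> by (cases "norm x = 0") auto
qed

lemma antilinear_functional_representation:
  assumes add: "\<And>x y. f (x + y) = f x + f y" and scale: "\<And>a x. f (scl' X a x) = kconj a * f x"
    and bound: "\<And>x. norm (f x) \<le> K * norm x"
  shows "\<exists>!h. \<forall>y. pairing X h y = f y"
proof -
  obtain z where z: "\<And>x. f x = ip' X z x"
    by (rule dual.riesz_representation_antilinear[of f K]) (use assms in auto)
  show ?thesis
  proof (rule ex1I)
    show "\<forall>y. pairing X (riesz' X z) y = f y"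
      by (simp add: pairing_riesz' z)
  qed (auto simp: pairing_riesz' z intro!: primal_ext)
qed

lemma linear_functional_representation:
  assumes "\<And>x y. f (x + y) = f x + f y" and "\<And>a x. f (scl X a x) = a * f x"
    and "\<And>x. norm (f x) \<le> K * norm x"
  shows "\<exists>!y. \<forall>x. f x = pairing X x y"
proof -
  obtain z where z: "\<And>x. f x = ip X x z"
    by (rule primal.riesz_representation[of f K]) (use assms in auto)
  show ?thesis
  proof (rule ex1I)
    show "\<forall>x. f x = pairing X x (riesz X z)"
      by (simp add: pairing_riesz z)
  qed (auto simp: pairing_riesz z intro!: dual_ext)
qed

end

lemma adj_eq:
  assumes X: "dual_pair_space X" and Y: "dual_pair_space Y"
    and F: "bounded_op (scl X) (scl Y) F"
  shows "pairing X x (adj (pairing X) (pairing Y) F y) = pairing Y (F x) y"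
proof -
  interpret X: dual_pair_space X by fact
  interpret Y: dual_pair_space Y by fact
  interpret F: bounded_linear F using F by (simp add: bounded_op_def)
  have "\<exists>!x'. \<forall>x. pairing Y (F x) y = pairing X x x'"
  proof (rule X.linear_functional_representation)
    show "norm (pairing Y (F x) y) \<le> (onorm F * norm y) * norm x" for x
      using Y.norm_pairing_le[of "F x" y] mult_right_mono[OF onorm[OF F.bounded_linear_axioms, of x], of "norm y"]
      by (simp add: mult_ac)
  next
    fix a x
    have "F (scl X a x) = scl Y a (F x)"
      using F unfolding bounded_op_def by blast
    then show "pairing Y (F (scl X a x)) y = a * pairing Y (F x) y"
      by (simp only: Y.pairing_scale_left)
  qed (simp add: F.add Y.pairing_add_left)
  from theI'[OF this, rule_format, of x] show ?thesis
    unfolding adj_def by (rule sym)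
qed

section \<open>Strongly continuous groups\<close>

text \<open>By Baire's theorem one of the closed sets on which all operators are bounded by \<open>n\<close> contains a
  ball; a bound on a ball around any point gives one on the unit ball.\<close>

lemma uniform_boundedness:
  fixes F :: "'i \<Rightarrow> 'a::banach \<Rightarrow> 'b::real_normed_vector"
  assumes lin: "\<And>i. i \<in> I \<Longrightarrow> bounded_linear (F i)"
    and pointwise: "\<And>x. \<exists>K. \<forall>i\<in>I. norm (F i x) \<le> K"
  obtains M where "0 \<le> M" "\<And>i x. i \<in> I \<Longrightarrow> norm (F i x) \<le> M * norm x"
proof -
  define C where "C n = (\<Inter>i\<in>I. {x. norm (F i x) \<le> real n})" for n
  have "closed (C n)" for n
    unfolding C_def
    by (intro closed_INT ballI closed_Collect_le continuous_intros
        bounded_linear.continuous_on[OF lin]) auto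
  have "\<Union>(range C) = UNIV"
  proof (intro set_eqI iffI UNIV_I)
    fix x
    obtain K where K: "\<And>i. i \<in> I \<Longrightarrow> norm (F i x) \<le> K"
      using pointwise by blast
    have "x \<in> C (nat \<lceil>K\<rceil>)"
      unfolding C_def using order_trans[OF K real_nat_ceiling_ge] by auto
    then show "x \<in> \<Union>(range C)"
      by blast
  qed
  have "\<exists>n. interior (C n) \<noteq> {}"
  proof (rule ccontr)
    assume "\<not> ?thesis"
    then have "euclidean interior_of \<Union>(range C) = {}"
      using \<open>\<And>n. closed (C n)\<close>
      by (intro Baire_category_alt) (auto simp: completely_metrizable_space_euclidean)
    then show False
      using \<open>\<Union>(range C) = UNIV\<close> by simp
  qed
  then obtain n x0 e where e: "0 < e" "ball x0 e \<subseteq> C n"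
    by (metis ex_in_conv mem_interior)
  have C: "norm (F i x) \<le> real n" if "i \<in> I" "dist x0 x < e" for i x
    using e(2) that unfolding C_def by auto
  show thesis
  proof (rule that)
    show "0 \<le> 4 * real n / e"
      using e by simp
    fix i x assume i: "i \<in> I"
    interpret bounded_linear "F i" by (rule lin[OF i])
    show "norm (F i x) \<le> 4 * real n / e * norm x"
    proof (cases "x = 0")
      case False
      define c where "c = e / (2 * norm x)"
      have c: "c > 0" using False e by (simp add: c_def)
      have "norm (F i (x0 + c *\<^sub>R x)) \<le> real n" "norm (F i x0) \<le> real n"
        using e False by (auto intro!: C[OF i] simp: dist_norm c_def)
      moreover have "c *\<^sub>R F i x = F i (x0 + c *\<^sub>R x) - F i x0"
        by (simp add: add scaleR)
      ultimately have "norm (c *\<^sub>R F i x) \<le> 2 * real n"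
        using norm_triangle_ineq4[of "F i (x0 + c *\<^sub>R x)" "F i x0"] by simp
      then have "c * norm (F i x) \<le> 2 * real n"
        using c by simp
      then show ?thesis
        using False e by (simp add: c_def field_simps)
    qed (simp add: zero)
  qed
qed

lemma vector_derivative_bound:
  fixes f :: "real \<Rightarrow> 'a::real_normed_vector"
  assumes "\<And>t. t \<in> closed_segment a b \<Longrightarrow> (f has_vector_derivative f' t) (at t)"
    and "\<And>t. t \<in> closed_segment a b \<Longrightarrow> norm (f' t) \<le> B"
  shows "norm (f b - f a) \<le> B * \<bar>b - a\<bar>"
proof -
  have "norm (f b - f a) \<le> B * norm (b - a)"
  proof (rule differentiable_bound[where S = "closed_segment a b" and f' = "\<lambda>t h. h *\<^sub>R f' t"])
    show "(f has_derivative (\<lambda>h. h *\<^sub>R f' t)) (at t within closed_segment a b)"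
      if "t \<in> closed_segment a b" for t
      using assms(1)[OF that] has_vector_derivative_at_within
      unfolding has_vector_derivative_def by blast
    show "onorm (\<lambda>h. h *\<^sub>R f' t) \<le> B" if "t \<in> closed_segment a b" for t
      using mult_right_mono[OF assms(2)[OF that] abs_ge_zero]
      by (intro onorm_le) (simp add: mult.commute)
  qed auto
  then show ?thesis by simp
qed

text \<open>The antiderivative is only claimed on a bounded interval, which allows it to be an integral
  from a fixed left end point.\<close>

lemma continuous_antiderivative:
  fixes f :: "real \<Rightarrow> 'a::banach"
  assumes "continuous_on UNIV f"
  obtains F where "\<And>t. \<bar>t\<bar> < r \<Longrightarrow> (F has_vector_derivative f t) (at t)"
proof
  fix t assume t: "\<bar>t\<bar> < r"
  have "((\<lambda>u. integral {-r..u} f) has_vector_derivative f t) (at t within {-r..r})"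
    using t by (intro integral_has_vector_derivative continuous_on_subset[OF assms]) auto
  then show "((\<lambda>u. integral {-r..u} f) has_vector_derivative f t) (at t)"
    using t by (subst (asm) at_within_interior) auto
qed

lemma has_vector_derivative_at_iff:
  "(f has_vector_derivative f') (at t) \<longleftrightarrow>
    ((\<lambda>h. (1 / h) *\<^sub>R (f (t + h) - f t)) \<longlongrightarrow> f') (at (0::real))"
proof -
  have "(f has_vector_derivative f') (at t) \<longleftrightarrow>
      (\<lambda>h. norm (f (t + h) - f t - h *\<^sub>R f') / norm h) \<midarrow>0\<rightarrow> 0"
    unfolding has_vector_derivative_def has_derivative_at
    by (simp add: bounded_linear_scaleR_left)
  also have "\<dots> \<longleftrightarrow> ((\<lambda>h. norm ((1 / h) *\<^sub>R (f (t + h) - f t) - f')) \<longlongrightarrow> 0) (at 0)"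
  proof (rule filterlim_cong[OF refl refl])
    show "\<forall>\<^sub>F h in at 0. norm (f (t + h) - f t - h *\<^sub>R f') / norm h
        = norm ((1 / h) *\<^sub>R (f (t + h) - f t) - f')"
      unfolding eventually_at_filter
    proof (intro always_eventually allI impI)
      fix h :: real assume "h \<noteq> 0"
      then have "(1 / h) *\<^sub>R (f (t + h) - f t) - f' = (1 / h) *\<^sub>R (f (t + h) - f t - h *\<^sub>R f')"
        by (simp add: scaleR_diff_right)
      then show "norm (f (t + h) - f t - h *\<^sub>R f') / norm h
          = norm ((1 / h) *\<^sub>R (f (t + h) - f t) - f')"
        by simp
    qed
  qed
  also have "\<dots> \<longleftrightarrow> ((\<lambda>h. (1 / h) *\<^sub>R (f (t + h) - f t)) \<longlongrightarrow> f') (at 0)"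
    unfolding tendsto_norm_zero_iff by (rule Lim_null[symmetric])
  finally show ?thesis .
qed

locale operator_group =
  fixes S :: "real \<Rightarrow> 'x::banach \<Rightarrow> 'x"
  assumes bounded_linear_S: "bounded_linear (S t)"
    and S_0: "S 0 x = x"
    and S_add: "S (t + r) x = S t (S r x)"
    and continuous_S: "continuous_on UNIV (\<lambda>t. S t x)"
begin

lemma S_commute: "S t (S r x) = S r (S t x)"
  by (metis S_add add.commute)

lemma locally_bounded:
  obtains M where "0 \<le> M" "\<And>t x. \<bar>t\<bar> \<le> r \<Longrightarrow> norm (S t x) \<le> M * norm x"
proof -
  have "\<exists>K. \<forall>t\<in>{-r..r}. norm (S t x) \<le> K" for x
  proof -
    have "bounded ((\<lambda>t. S t x) ` {-r..r})"
      by (intro compact_imp_bounded compact_continuous_image continuous_on_subset[OF continuous_S]) auto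
    then show ?thesis
      unfolding bounded_iff by auto
  qed
  then obtain M where "0 \<le> M" "\<And>t x. t \<in> {-r..r} \<Longrightarrow> norm (S t x) \<le> M * norm x"
    using uniform_boundedness[of "{-r..r}" S] bounded_linear_S by metis
  then show thesis
    using that[of M] by (simp add: abs_le_iff minus_le_iff)
qed

lemma gen_dom_iff: "x \<in> gen_dom S \<longleftrightarrow> (\<exists>y. ((\<lambda>t. S t x) has_vector_derivative y) (at 0))"
  unfolding gen_dom_def has_vector_derivative_at_iff by (simp add: S_0)

lemma gen_eq: "((\<lambda>t. S t x) has_vector_derivative y) (at 0) \<Longrightarrow> x \<in> gen_dom S \<and> gen S x = y"
  unfolding gen_dom_def gen_def has_vector_derivative_at_iff by (auto simp: S_0 intro!: tendsto_Lim)

lemma derivative_0: "x \<in> gen_dom S \<Longrightarrow> ((\<lambda>t. S t x) has_vector_derivative gen S x) (at 0)"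
  using gen_eq gen_dom_iff by metis

lemma derivative_S:
  assumes "x \<in> gen_dom S"
  shows "((\<lambda>t. S t x) has_vector_derivative S r (gen S x)) (at r)"
proof -
  interpret bounded_linear "S r" by (rule bounded_linear_S)
  have "((\<lambda>t. (1 / t) *\<^sub>R (S t x - x)) \<longlongrightarrow> gen S x) (at 0)"
    using derivative_0[OF assms] by (simp add: has_vector_derivative_at_iff S_0)
  from tendsto[OF this] show ?thesis
    by (simp add: has_vector_derivative_at_iff S_add scaleR diff)
qed

lemma gen_dom_S:
  assumes "x \<in> gen_dom S"
  shows "S r x \<in> gen_dom S" "gen S (S r x) = S r (gen S x)"
proof -
  interpret bounded_linear "S r" by (rule bounded_linear_S)
  have "((\<lambda>t. (1 / t) *\<^sub>R (S t x - x)) \<longlongrightarrow> gen S x) (at 0)"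
    using derivative_0[OF assms] by (simp add: has_vector_derivative_at_iff S_0)
  from tendsto[OF this] have "((\<lambda>t. S t (S r x)) has_vector_derivative S r (gen S x)) (at 0)"
    by (simp add: has_vector_derivative_at_iff scaleR diff S_0 S_commute[of r])
  then show "S r x \<in> gen_dom S" "gen S (S r x) = S r (gen S x)"
    using gen_eq by auto
qed

text \<open>For an antiderivative \<open>F\<close> of an orbit, the increments \<open>F h - F 0\<close>, that is \<open>h\<close> times the means
  of the orbit over \<open>[0, h]\<close>, lie in the domain of the generator, because \<open>S\<close> shifts \<open>F\<close> up to constants;
  the means tend to the initial point.\<close>

lemma gen_dom_dense: "closure (gen_dom S) = UNIV"
proof (intro set_eqI iffI UNIV_I)
  fix x
  obtain F where F: "\<And>t. \<bar>t\<bar> < 3 \<Longrightarrow> (F has_vector_derivative S t x) (at t)"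
    using continuous_antiderivative[OF continuous_S] by blast
  have shift: "S t (F h - F 0) = F (t + h) - F t" if "\<bar>t\<bar> < 1" "0 < h" "h < 1" for t h
  proof -
    interpret bounded_linear "S t" by (rule bounded_linear_S)
    have "((\<lambda>h. S t (F h) - F (t + h)) has_vector_derivative 0) (at u within {0..1})"
      if "u \<in> {0..1}" for u
    proof -
      have "((\<lambda>h. F (t + h)) has_vector_derivative S (t + u) x) (at u)"
        using F[of "t + u"] abs_triangle_ineq[of t u] \<open>\<bar>t\<bar> < 1\<close> that
        by (simp add: has_vector_derivative_at_iff add.assoc)
      moreover have "((\<lambda>h. S t (F h)) has_vector_derivative S t (S u x)) (at u)"
        using that by (intro has_vector_derivative F) auto
      ultimately have "((\<lambda>h. S t (F h) - F (t + h)) has_vector_derivative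
          S t (S u x) - S (t + u) x) (at u)"
        by (intro has_vector_derivative_diff)
      then show ?thesis
        by (simp add: S_add has_vector_derivative_at_within)
    qed
    then have "S t (F h) - F (t + h) = S t (F 0) - F (t + 0)"
      using that unfolding has_vector_derivative_def
      by (intro has_derivative_zero_unique[OF convex_real_interval(5), of 0 1]) auto
    then show ?thesis
      by (simp add: diff algebra_simps)
  qed
  have mem: "F h - F 0 \<in> gen_dom S" if "0 < h" "h < 1" for h
  proof -
    have "((\<lambda>t. F (t + h) - F t) has_vector_derivative S h x - S 0 x) (at 0)"
    proof (intro has_vector_derivative_diff F)
      show "((\<lambda>t. F (t + h)) has_vector_derivative S h x) (at 0)"
        using F[of h] that by (simp add: has_vector_derivative_at_iff add.commute)
    qed simp
    then have "((\<lambda>t. S t (F h - F 0)) has_vector_derivative S h x - S 0 x) (at 0)"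
      by (rule has_vector_derivative_transform_within_open[where S = "{-1<..<1}"])
        (use that shift in auto)
    then show ?thesis
      using gen_dom_iff by blast
  qed
  have sc: "r *\<^sub>R z \<in> gen_dom S" if "z \<in> gen_dom S" for r z
  proof -
    have "S t (r *\<^sub>R z) = r *\<^sub>R S t z" for t
      using bounded_linear.linear[OF bounded_linear_S] linear_cmul by blast
    then show ?thesis
      using bounded_linear.has_vector_derivative[OF bounded_linear_scaleR_right derivative_0[OF that]]
      unfolding gen_dom_iff by auto
  qed
  have "((\<lambda>h. (1 / h) *\<^sub>R (F h - F 0)) \<longlongrightarrow> x) (at 0)"
    using F[of 0] by (simp add: has_vector_derivative_at_iff S_0)
  then have "((\<lambda>h. (1 / h) *\<^sub>R (F h - F 0)) \<longlongrightarrow> x) (at_right 0)"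
    by (rule tendsto_within_subset) auto
  moreover have "\<forall>\<^sub>F h in at_right 0. (1 / h) *\<^sub>R (F h - F 0) \<in> closure (gen_dom S)"
    using eventually_at_right_real[OF zero_less_one]
    by (rule eventually_mono) (auto intro!: sc mem subsetD[OF closure_subset])
  ultimately show "x \<in> closure (gen_dom S)"
    by (intro Lim_in_closed_set[OF closed_closure _ trivial_limit_at_right_real])
qed

end

lemma operator_group_if_c0_group: "c0_group s S \<Longrightarrow> operator_group S"
  unfolding c0_group_def operator_group_def bounded_op_def by (metis comp_apply id_apply)

section \<open>The adjoint group and the observation operator\<close>

text \<open>Identities with values in a Hausdorff space extend from dense sets by continuity; this
  transfers identities from \<open>D(A)\<close> to \<open>H\<close>.\<close>

lemma eq_if_eq_on_dense:
  assumes "closure E = UNIV" and "continuous_on UNIV f" and "continuous_on UNIV g"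
    and "\<And>x. x \<in> E \<Longrightarrow> f x = g x"
  shows "f x = (g x :: 'z::t2_space)"
proof -
  have "closed {x. f x = g x}"
    using assms by (intro closed_Collect_eq)
  then have "closure E \<subseteq> {x. f x = g x}"
    using assms(4) by (intro closure_minimal) auto
  with assms(1) show ?thesis by auto
qed

text \<open>Density of \<open>D(A\<^sup>*)\<close> is a hypothesis here. It holds in the situation of the theorem since
  \<open>D(A\<^sup>*)\<close> is the domain of the generator of the strongly continuous group \<open>V\<close>.\<close>

locale adjoint_setting =
  fixes \<S> :: "('k::real_or_complex, 'h::{real_inner,banach}, 'hd::{real_inner,banach},
                'u::{real_inner,banach}, 'ud::{real_inner,banach}) control_system"
  assumes state_pair: "hilbert_dual_pair (state \<S>)"
    and control_pair: "hilbert_dual_pair (control \<S>)"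
    and group_expA: "c0_group (scl (state \<S>)) (expA \<S>)"
    and generates_opA: "generates (domA \<S>) (opA \<S>) (expA \<S>)"
    and opB_bounded:
      "bounded_op_antidual (scl (control \<S>)) (scl' (state \<S>)) (domAst \<S>) (graph_norm \<S>) (opB \<S>)"
    and domAst_dense: "closure (domAst \<S>) = UNIV"
begin

sublocale H: dual_pair_space "state \<S>"
  by unfold_locales (rule state_pair)

sublocale U: dual_pair_space "control \<S>"
  by unfold_locales (rule control_pair)

sublocale expA: operator_group "expA \<S>"
  by (rule operator_group_if_c0_group[OF group_expA])

abbreviation "pr \<equiv> pairing (state \<S>)"
abbreviation "D \<equiv> domAst \<S>"
abbreviation "Ast \<equiv> opAst \<S>"
abbreviation "Tst \<equiv> expAst \<S>"
abbreviation "Bst \<equiv> opBst \<S>"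

lemma domA_eq: "domA \<S> = gen_dom (expA \<S>)"
  and opA_eq: "x \<in> domA \<S> \<Longrightarrow> opA \<S> x = gen (expA \<S>) x"
  using generates_opA unfolding generates_def by auto

lemma domA_dense: "closure (domA \<S>) = UNIV"
  by (simp add: domA_eq expA.gen_dom_dense)

text \<open>Density of \<open>D(A)\<close> makes the adjoint single-valued.\<close>

lemma opAst_unique:
  assumes "\<And>x. x \<in> domA \<S> \<Longrightarrow> pr (opA \<S> x) y = pr x z"
  shows "y \<in> D" "Ast y = z"
proof -
  show "y \<in> D"
    unfolding domAst_def using assms by auto
  show "Ast y = z"
    unfolding opAst_def
  proof (rule the_equality)
    fix z' assume z': "\<forall>x\<in>domA \<S>. pr (opA \<S> x) y = pr x z'"
    have "pr x z' = pr x z" for x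
      by (rule eq_if_eq_on_dense[OF domA_dense])
        (use assms z' in \<open>auto intro!: continuous_intros H.pairing.continuous_on\<close>)
    then show "z' = z"
      by (rule H.dual_ext)
  qed (use assms in blast)
qed

lemma pairing_opAst:
  assumes "y \<in> D" "x \<in> domA \<S>"
  shows "pr (opA \<S> x) y = pr x (Ast y)"
proof -
  obtain z where z: "\<And>x. x \<in> domA \<S> \<Longrightarrow> pr (opA \<S> x) y = pr x z"
    using assms(1) unfolding domAst_def by auto
  with opAst_unique(2)[OF z] assms(2) show ?thesis by simp
qed

lemma domAst_add: "y \<in> D \<Longrightarrow> z \<in> D \<Longrightarrow> y + z \<in> D"
  and opAst_add: "y \<in> D \<Longrightarrow> z \<in> D \<Longrightarrow> Ast (y + z) = Ast y + Ast z"
  using opAst_unique[of "y + z" "Ast y + Ast z"]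
  by (auto simp: H.pairing_add_right pairing_opAst)

lemma domAst_scale: "y \<in> D \<Longrightarrow> scl' (state \<S>) a y \<in> D"
  and opAst_scale: "y \<in> D \<Longrightarrow> Ast (scl' (state \<S>) a y) = scl' (state \<S>) a (Ast y)"
  using opAst_unique[of "scl' (state \<S>) a y" "scl' (state \<S>) a (Ast y)"]
  by (auto simp: H.pairing_scale_right pairing_opAst)

lemma domAst_scaleR: "y \<in> D \<Longrightarrow> r *\<^sub>R y \<in> D"
  and opAst_scaleR: "y \<in> D \<Longrightarrow> Ast (r *\<^sub>R y) = r *\<^sub>R Ast y"
  using domAst_scale[of y "of_real r"] opAst_scale[of y "of_real r"]
  by (simp_all add: H.dual.scale_of_real)

lemma domAst_diff: "y \<in> D \<Longrightarrow> z \<in> D \<Longrightarrow> y - z \<in> D"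
  and opAst_diff: "y \<in> D \<Longrightarrow> z \<in> D \<Longrightarrow> Ast (y - z) = Ast y - Ast z"
  using domAst_add[of y "(-1) *\<^sub>R z"] opAst_add[of y "(-1) *\<^sub>R z"]
    domAst_scaleR[of z "-1"] opAst_scaleR[of z "-1"] by simp_all

lemma domAst_0: "0 \<in> D" and opAst_0: "Ast 0 = 0"
proof -
  obtain y where "y \<in> D"
    using domAst_dense by (metis closure_empty empty_not_UNIV ex_in_conv)
  then show "0 \<in> D" "Ast 0 = 0"
    using domAst_scaleR[of y 0] opAst_scaleR[of y 0] by simp_all
qed

lemma pairing_expAst: "pr x (Tst t y) = pr (expA \<S> t x) y"
  unfolding expAst_def
  by (rule adj_eq) (use group_expA in \<open>auto simp: c0_group_def intro: H.dual_pair_space_axioms\<close>)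

lemma expAst_unique: "(\<And>x. pr x z = pr (expA \<S> t x) y) \<Longrightarrow> Tst t y = z"
  by (rule H.dual_ext) (simp add: pairing_expAst)

lemma expAst_add: "Tst t (y + z) = Tst t y + Tst t z"
  by (rule expAst_unique) (simp add: H.pairing_add_right pairing_expAst)

lemma expAst_scale: "Tst t (scl' (state \<S>) a y) = scl' (state \<S>) a (Tst t y)"
  by (rule expAst_unique) (simp add: H.pairing_scale_right pairing_expAst)

lemma expAst_diff: "Tst t (y - z) = Tst t y - Tst t z"
  by (rule expAst_unique) (simp add: H.pairing.diff_right pairing_expAst)

lemma expAst_zero: "Tst 0 y = y"
  by (rule expAst_unique) (simp add: expA.S_0)

lemma expAst_plus: "Tst (t + r) y = Tst t (Tst r y)"
  by (rule expAst_unique) (simp add: expA.S_add expA.S_commute[of t r] pairing_expAst)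

lemma expAst_locally_bounded:
  obtains M where "0 \<le> M" "\<And>t y. \<bar>t\<bar> \<le> r \<Longrightarrow> norm (Tst t y) \<le> M * norm y"
proof -
  obtain M where M: "0 \<le> M" "\<And>t x. \<bar>t\<bar> \<le> r \<Longrightarrow> norm (expA \<S> t x) \<le> M * norm x"
    using expA.locally_bounded by blast
  have "norm (Tst t y) \<le> M * norm y" if "\<bar>t\<bar> \<le> r" for t y
  proof (rule H.norm_dual_le)
    fix x
    have "norm (pr x (Tst t y)) \<le> norm (expA \<S> t x) * norm y"
      unfolding pairing_expAst by (rule H.norm_pairing_le)
    also have "\<dots> \<le> (M * norm x) * norm y"
      by (intro mult_right_mono M(2) that) auto
    finally show "norm (pr x (Tst t y)) \<le> M * norm y * norm x"
      by (simp add: mult_ac)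
  qed (use M in auto)
  with M(1) show thesis
    by (rule that)
qed

lemma expAst_domAst:
  assumes "y \<in> D"
  shows "Tst t y \<in> D" "Ast (Tst t y) = Tst t (Ast y)"
proof -
  have "pr (opA \<S> x) (Tst t y) = pr x (Tst t (Ast y))" if x: "x \<in> domA \<S>" for x
  proof -
    have "pr (opA \<S> x) (Tst t y) = pr (opA \<S> (expA \<S> t x)) y"
      using expA.gen_dom_S[of x t] x by (simp add: pairing_expAst opA_eq domA_eq)
    also have "\<dots> = pr x (Tst t (Ast y))"
      using expA.gen_dom_S[of x t] x by (simp add: pairing_opAst assms domA_eq pairing_expAst)
    finally show ?thesis .
  qed
  then show "Tst t y \<in> D" "Ast (Tst t y) = Tst t (Ast y)"
    by (auto intro: opAst_unique)
qed

text \<open>Weak differentiability of the orbits of the adjoint group is immediate from duality with the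
  orbits in \<open>domA \<S>\<close>; the mean value inequality, uniformly over the unit ball of the state space,
  turns it into norm estimates.\<close>

lemma expAst_increment_bound:
  assumes y: "y \<in> D"
    and B: "\<And>r. r \<in> closed_segment s t \<Longrightarrow> norm (Tst r (Ast y) - z) \<le> B"
  shows "norm (Tst t y - Tst s y - (t - s) *\<^sub>R z) \<le> B * \<bar>t - s\<bar>"
proof (rule H.norm_dual_le)
  have "0 \<le> B"
    using B[of s] by (auto intro: order_trans[OF norm_ge_zero])
  then show "0 \<le> B * \<bar>t - s\<bar>" by simp
  define w where "w = Tst t y - Tst s y - (t - s) *\<^sub>R z"
  have dom: "norm (pr x w) \<le> B * \<bar>t - s\<bar> * norm x" if x: "x \<in> domA \<S>" for x
  proof -
    define f where "f r = pr x (Tst r y) - r *\<^sub>R pr x z" for r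
    have "norm (f t - f s) \<le> (B * norm x) * \<bar>t - s\<bar>"
    proof (rule vector_derivative_bound)
      fix r assume r: "r \<in> closed_segment s t"
      have "((\<lambda>r. pr (expA \<S> r x) y) has_vector_derivative pr (expA \<S> r (opA \<S> x)) y) (at r)"
        using x by (intro bounded_linear.has_vector_derivative[OF H.pairing.bounded_linear_left])
          (simp add: domA_eq opA_eq expA.derivative_S)
      moreover have "pr (expA \<S> r (opA \<S> x)) y = pr x (Tst r (Ast y))"
        using x expAst_domAst[OF y, of r] by (simp add: pairing_opAst flip: pairing_expAst)
      ultimately show "(f has_vector_derivative pr x (Tst r (Ast y) - z)) (at r)"
        unfolding f_def H.pairing.diff_right pairing_expAst
        by (auto intro!: derivative_eq_intros)
      have "norm (pr x (Tst r (Ast y) - z)) \<le> norm x * norm (Tst r (Ast y) - z)"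
        by (rule H.norm_pairing_le)
      also have "\<dots> \<le> norm x * B"
        by (intro mult_left_mono B r) auto
      finally show "norm (pr x (Tst r (Ast y) - z)) \<le> B * norm x"
        by (simp add: mult.commute)
    qed
    moreover have "f t - f s = pr x w"
      unfolding f_def w_def
      by (simp only: H.pairing.diff_right H.pairing_scaleR_right scaleR_left_diff_distrib)
        (simp add: algebra_simps)
    ultimately show ?thesis
      by (simp add: mult_ac)
  qed
  have "closed {x. norm (pr x w) \<le> B * \<bar>t - s\<bar> * norm x}"
    by (intro closed_Collect_le continuous_intros H.pairing.continuous_on)
  then have "closure (domA \<S>) \<subseteq> {x. norm (pr x w) \<le> B * \<bar>t - s\<bar> * norm x}"
    using dom by (intro closure_minimal) auto
  then show "norm (pr x (Tst t y - Tst s y - (t - s) *\<^sub>R z)) \<le> B * \<bar>t - s\<bar> * norm x" for x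
    unfolding domA_dense w_def by auto
qed

text \<open>On \<open>D(A\<^sup>*)\<close> the orbits are locally Lipschitz; general orbits are locally uniform limits of
  these, since the group is locally bounded and \<open>D(A\<^sup>*)\<close> is dense.\<close>

lemma continuous_expAst: "continuous_on UNIV (\<lambda>t. Tst t y)"
proof -
  have "continuous_on {-r<..<r} (\<lambda>t. Tst t y)" if "r > 0" for r
  proof -
    obtain M where M: "0 \<le> M" "\<And>t y. \<bar>t\<bar> \<le> r \<Longrightarrow> norm (Tst t y) \<le> M * norm y"
      using expAst_locally_bounded by metis
    have "y \<in> closure D"
      using domAst_dense by simp
    then obtain Y where Y: "\<And>n. Y n \<in> D" "Y \<longlonglongrightarrow> y"
      unfolding closure_sequential by auto
    show ?thesis
    proof (rule uniform_limit_theorem[where f = "\<lambda>n t. Tst t (Y n)" and F = sequentially])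
      have "continuous_on {-r<..<r} (\<lambda>t. Tst t (Y n))" for n
      proof (rule lipschitz_on_continuous_on)
        show "(M * norm (Ast (Y n)))-lipschitz_on {-r<..<r} (\<lambda>t. Tst t (Y n))"
        proof (rule lipschitz_onI)
          fix s t assume st: "s \<in> {-r<..<r}" "t \<in> {-r<..<r}"
          have "norm (Tst s (Y n) - Tst t (Y n) - (s - t) *\<^sub>R 0) \<le> M * norm (Ast (Y n)) * \<bar>s - t\<bar>"
          proof (rule expAst_increment_bound[OF Y(1)])
            fix u assume "u \<in> closed_segment t s"
            then have "\<bar>u\<bar> \<le> r"
              using st by (auto simp: closed_segment_eq_real_ivl split: if_splits)
            then show "norm (Tst u (Ast (Y n)) - 0) \<le> M * norm (Ast (Y n))"
              using M(2) by simp
          qed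
          then show "dist (Tst s (Y n)) (Tst t (Y n)) \<le> M * norm (Ast (Y n)) * dist s t"
            by (simp add: dist_norm)
        qed (use M in auto)
      qed
      then show "\<forall>\<^sub>F n in sequentially. continuous_on {-r<..<r} (\<lambda>t. Tst t (Y n))"
        by simp
      show "uniform_limit {-r<..<r} (\<lambda>n t. Tst t (Y n)) (\<lambda>t. Tst t y) sequentially"
      proof (rule uniform_limitI)
        fix e :: real assume "e > 0"
        then have "\<forall>\<^sub>F n in sequentially. dist (Y n) y < e / (M + 1)"
          using tendstoD[OF Y(2), of "e / (M + 1)"] M(1) by simp
        then show "\<forall>\<^sub>F n in sequentially. \<forall>t\<in>{-r<..<r}. dist (Tst t (Y n)) (Tst t y) < e"
        proof (rule eventually_mono, intro ballI)
          fix n t assume n: "dist (Y n) y < e / (M + 1)" and t: "t \<in> {-r<..<r}"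
          have "dist (Tst t (Y n)) (Tst t y) \<le> M * dist (Y n) y"
            using M(2)[of t "Y n - y"] t by (simp add: dist_norm expAst_diff abs_le_iff)
          also have "\<dots> \<le> (M + 1) * dist (Y n) y"
            by (intro mult_right_mono) auto
          also have "\<dots> < e"
            using n M(1) by (simp add: field_simps)
          finally show "dist (Tst t (Y n)) (Tst t y) < e" .
        qed
      qed
    qed simp
  qed
  note loc = this
  have "isCont (\<lambda>t. Tst t y) t" for t
    by (rule continuous_on_interior[OF loc[of "\<bar>t\<bar> + 1"]]) (auto simp: interior_open)
  then show ?thesis
    by (simp add: continuous_at_imp_continuous_on)
qed

text \<open>Lemma \<open>expAst_increment_bound\<close> with \<open>z = A\<^sup>*y\<close> reduces differentiability of the orbit of
  \<open>y\<close> to continuity of the orbit of \<open>A\<^sup>*y\<close>.\<close>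

lemma derivative_expAst:
  assumes y: "y \<in> D"
  shows "((\<lambda>t. Tst t y) has_vector_derivative Ast y) (at 0)"
  unfolding has_vector_derivative_at_iff
proof (rule tendstoI)
  fix e :: real assume "e > 0"
  have "isCont (\<lambda>t. Tst t (Ast y)) 0"
    using continuous_expAst by (simp add: continuous_on_eq_continuous_at)
  then obtain d where d: "d > 0" "\<And>r. \<bar>r\<bar> < d \<Longrightarrow> norm (Tst r (Ast y) - Ast y) < e / 2"
    using half_gt_zero[OF \<open>e > 0\<close>] unfolding continuous_at_eps_delta
    by (metis expAst_zero dist_norm diff_0_right real_norm_def)
  have "dist ((1 / h) *\<^sub>R (Tst (0 + h) y - Tst 0 y)) (Ast y) < e" if h: "h \<noteq> 0" "\<bar>h\<bar> < d" for h
  proof -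
    have "norm (Tst h y - Tst 0 y - (h - 0) *\<^sub>R Ast y) \<le> e / 2 * \<bar>h - 0\<bar>"
    proof (rule expAst_increment_bound[OF y])
      fix r assume "r \<in> closed_segment 0 h"
      then have "\<bar>r\<bar> < d"
        using h by (auto simp: closed_segment_eq_real_ivl split: if_splits)
      then show "norm (Tst r (Ast y) - Ast y) \<le> e / 2"
        using d(2) by (simp add: less_imp_le)
    qed
    moreover have "(1 / h) *\<^sub>R (Tst (0 + h) y - Tst 0 y) - Ast y
        = (1 / h) *\<^sub>R (Tst h y - Tst 0 y - (h - 0) *\<^sub>R Ast y)"
      using h by (simp add: scaleR_diff_right)
    ultimately have "norm ((1 / h) *\<^sub>R (Tst (0 + h) y - Tst 0 y) - Ast y) \<le> e / 2"
      using h by (simp add: divide_le_eq)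
    then show ?thesis
      using \<open>e > 0\<close> by (simp add: dist_norm)
  qed
  then show "\<forall>\<^sub>F h in at 0. dist ((1 / h) *\<^sub>R (Tst (0 + h) y - Tst 0 y)) (Ast y) < e"
    unfolding eventually_at using d(1) by (auto simp: dist_norm)
qed

subsection \<open>The operator \<open>B\<^sup>*\<close>\<close>

lemma graph_norm_nonneg: "0 \<le> graph_norm \<S> y"
  by (simp add: graph_norm_def)

lemma graph_norm_le: "graph_norm \<S> y \<le> norm y + norm (Ast y)"
  unfolding graph_norm_def by (rule sqrt_sum_squares_le_sum) auto

lemma graph_norm_scaleR: "y \<in> D \<Longrightarrow> graph_norm \<S> (a *\<^sub>R y) = \<bar>a\<bar> * graph_norm \<S> y"
  unfolding graph_norm_def
  by (simp add: opAst_scaleR power_mult_distrib real_sqrt_mult flip: distrib_left)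

lemma antidual_bound:
  assumes "f \<in> antidual (scl' (state \<S>)) D (graph_norm \<S>)" "y \<in> D"
  shows "norm (f y) \<le> antidual_norm D (graph_norm \<S>) f * graph_norm \<S> y"
  using assms
  by (rule norm_antidual_le)
    (auto simp: graph_norm_nonneg H.dual.scale_of_real domAst_scaleR graph_norm_scaleR assms(2))

lemma bounded_op_antidual_bound:
  assumes "bounded_op_antidual s (scl' (state \<S>)) D (graph_norm \<S>) F"
  obtains K where "0 \<le> K" "\<And>x y. y \<in> D \<Longrightarrow> norm (F x y) \<le> K * norm x * graph_norm \<S> y"
proof -
  obtain K where K: "\<And>x. antidual_norm D (graph_norm \<S>) (F x) \<le> K * norm x"
    using assms unfolding bounded_op_antidual_def by blast
  have "norm (F x y) \<le> max K 0 * norm x * graph_norm \<S> y" if "y \<in> D" for x y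
  proof -
    have "F x \<in> antidual (scl' (state \<S>)) D (graph_norm \<S>)"
      using assms unfolding bounded_op_antidual_def by blast
    then have "norm (F x y) \<le> antidual_norm D (graph_norm \<S>) (F x) * graph_norm \<S> y"
      using that by (rule antidual_bound)
    also have "\<dots> \<le> (max K 0 * norm x) * graph_norm \<S> y"
      using graph_norm_nonneg
      by (intro mult_right_mono order_trans[OF K]) auto
    finally show ?thesis .
  qed
  then show thesis
    by (intro that[of "max K 0"]) auto
qed

lemma opB_add_left: "opB \<S> (u + v) y = opB \<S> u y + opB \<S> v y"
  and opB_scale_left: "opB \<S> (scl (control \<S>) a u) y = a * opB \<S> u y"
  and opB_outside: "y \<notin> D \<Longrightarrow> opB \<S> u y = 0"
  and opB_add_right: "y \<in> D \<Longrightarrow> z \<in> D \<Longrightarrow> opB \<S> u (y + z) = opB \<S> u y + opB \<S> u z"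
  and opB_scale_right: "y \<in> D \<Longrightarrow> opB \<S> u (scl' (state \<S>) a y) = kconj a * opB \<S> u y"
  using opB_bounded unfolding bounded_op_antidual_def antidual_def by auto

lemma pairing_opBst:
  assumes "y \<in> D"
  shows "pairing (control \<S>) u (Bst y) = opB \<S> u y"
proof -
  obtain K where K: "\<And>u y. y \<in> D \<Longrightarrow> norm (opB \<S> u y) \<le> K * norm u * graph_norm \<S> y"
    using bounded_op_antidual_bound[OF opB_bounded] by metis
  have "\<exists>!x'. \<forall>u. opB \<S> u y = pairing (control \<S>) u x'"
  proof (rule U.linear_functional_representation)
    show "norm (opB \<S> u y) \<le> (K * graph_norm \<S> y) * norm u" for u
      using K[OF assms, of u] by (simp add: mult_ac)
  qed (simp_all add: opB_add_left opB_scale_left)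
  from theI'[OF this, rule_format, of u] show ?thesis
    unfolding opBst_def adj_def by (rule sym)
qed

lemma opBst_add: "y \<in> D \<Longrightarrow> z \<in> D \<Longrightarrow> Bst (y + z) = Bst y + Bst z"
  by (rule U.dual_ext)
    (simp add: pairing_opBst domAst_add U.pairing_add_right opB_add_right)

lemma opBst_scale: "y \<in> D \<Longrightarrow> Bst (scl' (state \<S>) a y) = scl' (control \<S>) a (Bst y)"
  by (rule U.dual_ext)
    (simp add: pairing_opBst domAst_scale U.pairing_scale_right opB_scale_right)

lemma opBst_diff: "y \<in> D \<Longrightarrow> z \<in> D \<Longrightarrow> Bst (y - z) = Bst y - Bst z"
  using opBst_add[of "y - z" z] domAst_diff[of y z] by simp

lemma opBst_bound:
  obtains K where "0 \<le> K" "\<And>y. y \<in> D \<Longrightarrow> norm (Bst y) \<le> K * graph_norm \<S> y"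
proof -
  obtain K where K: "0 \<le> K" "\<And>u y. y \<in> D \<Longrightarrow> norm (opB \<S> u y) \<le> K * norm u * graph_norm \<S> y"
    using bounded_op_antidual_bound[OF opB_bounded] by metis
  have "norm (Bst y) \<le> K * graph_norm \<S> y" if "y \<in> D" for y
    using K(1) K(2)[OF that] graph_norm_nonneg
    by (intro U.norm_dual_le) (auto simp: pairing_opBst that mult_ac)
  with K(1) show thesis
    by (rule that)
qed

text \<open>The observation of a state in \<open>D(A\<^sup>*)\<close> as a genuine, even continuous, function of time, whereas
  \<open>observation\<close> is determined up to null sets only.\<close>

definition outp :: "'hd \<Rightarrow> real \<Rightarrow> 'ud" where
  "outp y t = Bst (Tst (- t) y)"

lemma outp_add: "y \<in> D \<Longrightarrow> z \<in> D \<Longrightarrow> outp (y + z) t = outp y t + outp z t"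
  and outp_diff: "y \<in> D \<Longrightarrow> z \<in> D \<Longrightarrow> outp (y - z) t = outp y t - outp z t"
  and outp_scale: "y \<in> D \<Longrightarrow> outp (scl' (state \<S>) a y) t = scl' (control \<S>) a (outp y t)"
  by (simp_all add: outp_def expAst_add expAst_diff expAst_scale opBst_add opBst_diff
      opBst_scale expAst_domAst)

lemma outp_0: "outp y 0 = Bst y"
  by (simp add: outp_def expAst_zero)

lemma outp_shift: "outp (Tst (- h) y) t = outp y (t + h)"
  by (simp add: outp_def flip: expAst_plus)

text \<open>\<open>B\<^sup>*\<close> is bounded for the graph norm, and the orbit of \<open>y\<close> is continuous for it because
  \<open>A\<^sup>*\<close> commutes with the group.\<close>

lemma continuous_outp:
  assumes y: "y \<in> D"
  shows "continuous_on UNIV (outp y)"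
proof -
  obtain K where K: "0 \<le> K" "\<And>y. y \<in> D \<Longrightarrow> norm (Bst y) \<le> K * graph_norm \<S> y"
    using opBst_bound by metis
  have cont: "((\<lambda>t. Tst (- t) z) \<longlongrightarrow> Tst (- s) z) (at s)" for s z
  proof -
    have "continuous_on UNIV (\<lambda>t. Tst (- t) z)"
      by (rule continuous_on_compose2[OF continuous_expAst[of z]]) (auto intro: continuous_intros)
    then show ?thesis
      by (simp add: continuous_on_def)
  qed
  have "(outp y \<longlongrightarrow> outp y s) (at s)" for s
  proof (rule Lim_null[THEN iffD2], rule Lim_null_comparison)
    show "\<forall>\<^sub>F t in at s. norm (outp y t - outp y s)
        \<le> K * (norm (Tst (- t) y - Tst (- s) y) + norm (Tst (- t) (Ast y) - Tst (- s) (Ast y)))"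
    proof (intro always_eventually allI)
      fix t
      let ?z = "Tst (- t) y - Tst (- s) y"
      have "norm (outp y t - outp y s) = norm (Bst ?z)"
        unfolding outp_def by (simp add: opBst_diff expAst_domAst y)
      also have "\<dots> \<le> K * graph_norm \<S> ?z"
        by (intro K domAst_diff expAst_domAst y)
      also have "\<dots> \<le> K * (norm ?z + norm (Ast ?z))"
        by (intro mult_left_mono graph_norm_le K)
      finally show "norm (outp y t - outp y s)
          \<le> K * (norm ?z + norm (Tst (- t) (Ast y) - Tst (- s) (Ast y)))"
        by (simp add: opAst_diff expAst_domAst y)
    qed
    have "((\<lambda>t. K * (norm (Tst (- t) y - Tst (- s) y)
          + norm (Tst (- t) (Ast y) - Tst (- s) (Ast y)))) \<longlongrightarrow>
        K * (norm (Tst (- s) y - Tst (- s) y) + norm (Tst (- s) (Ast y) - Tst (- s) (Ast y)))) (at s)"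
      by (intro tendsto_intros cont)
    then show "((\<lambda>t. K * (norm (Tst (- t) y - Tst (- s) y)
          + norm (Tst (- t) (Ast y) - Tst (- s) (Ast y)))) \<longlongrightarrow> 0) (at s)"
      by simp
  qed
  then show ?thesis
    by (simp add: continuous_on_def)
qed

end

section \<open>The extended observation\<close>

lemma borel_measurable_lebesgue_continuous:
  "continuous_on UNIV f \<Longrightarrow> f \<in> borel_measurable (lebesgue :: real measure)"
  using continuous_imp_measurable_on_sets_lebesgue[of UNIV f] by (simp add: lebesgue_on_UNIV_eq)

lemma borel_measurable_lebesgue_AE:
  fixes f g :: "real \<Rightarrow> 'b::topological_space"
  assumes f: "f \<in> borel_measurable lebesgue" and ae: "AE t in lebesgue. f t = g t"
  shows "g \<in> borel_measurable lebesgue"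
proof (rule borel_measurableI)
  fix S :: "'b set" assume "open S"
  have sets: "f -` S \<inter> space lebesgue \<in> sets lebesgue"
    using f \<open>open S\<close> by (intro measurable_sets) auto
  have "AE t in lebesgue. t \<in> f -` S \<inter> space lebesgue \<longleftrightarrow> t \<in> g -` S \<inter> space lebesgue"
    using ae by eventually_elim auto
  then show "g -` S \<inter> space lebesgue \<in> sets lebesgue"
    by (rule completion.in_sets_AE[OF _ sets]) simp
qed

lemma borel_measurable_lebesgue_AE_limit:
  fixes f :: "nat \<Rightarrow> real \<Rightarrow> 'b::metric_space"
  assumes f: "\<And>n. f n \<in> borel_measurable lebesgue"
    and ae: "AE t in lebesgue. (\<lambda>n. f n t) \<longlonglongrightarrow> g t"
  shows "g \<in> borel_measurable lebesgue"
proof -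
  obtain N where N: "N \<in> null_sets lebesgue" "\<And>t. t \<notin> N \<Longrightarrow> (\<lambda>n. f n t) \<longlonglongrightarrow> g t"
    using ae by (auto elim: AE_E3)
  fix c :: 'b
  have "(\<lambda>t. if t \<in> N then c else g t) \<in> borel_measurable lebesgue"
  proof (rule borel_measurable_LIMSEQ_metric)
    show "(\<lambda>t. if t \<in> N then c else f n t) \<in> borel_measurable lebesgue" for n
      using N(1) f by (intro measurable_If_set) (auto simp: null_setsD2)
  qed (use N(2) in auto)
  moreover have "AE t in lebesgue. (if t \<in> N then c else g t) = g t"
    using AE_not_in[OF N(1)] by eventually_elim auto
  ultimately show ?thesis
    by (rule borel_measurable_lebesgue_AE)
qed

text \<open>A difference of Borel functions with values in a non-separable space need not be Borel; it is
  if one of them is continuous, hence a pointwise limit of functions with countably many values.\<close>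

lemma borel_measurable_dist_continuous:
  fixes f c :: "real \<Rightarrow> 'b::metric_space"
  assumes f: "f \<in> borel_measurable lebesgue" and c: "continuous_on UNIV c"
  shows "(\<lambda>t. dist (c t) (f t)) \<in> borel_measurable lebesgue"
proof (rule borel_measurable_LIMSEQ_metric)
  fix n :: nat
  show "(\<lambda>t. dist (c (of_int \<lfloor>real (Suc n) * t\<rfloor> / real (Suc n))) (f t)) \<in> borel_measurable lebesgue"
  proof (rule measurable_compose_countable[where f = "\<lambda>i t. dist (c (of_int i / real (Suc n))) (f t)"])
    show "(\<lambda>t. dist (c (of_int i / real (Suc n))) (f t)) \<in> borel_measurable lebesgue" for i
      by (rule measurable_compose[OF f])
        (intro borel_measurable_continuous_onI continuous_intros)
    show "(\<lambda>t. \<lfloor>real (Suc n) * t\<rfloor>) \<in> lebesgue \<rightarrow>\<^sub>M count_space UNIV"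
      by (intro measurable_compose[OF _ measurable_real_floor]
          borel_measurable_lebesgue_continuous continuous_intros)
  qed
next
  fix t :: real
  have "(\<lambda>n. of_int \<lfloor>real (Suc n) * t\<rfloor> / real (Suc n)) \<longlonglongrightarrow> t"
  proof (rule real_tendsto_sandwich)
    show "\<forall>\<^sub>F n in sequentially. t - 1 / real (Suc n) \<le> of_int \<lfloor>real (Suc n) * t\<rfloor> / real (Suc n)"
    proof (intro always_eventually allI)
      fix n
      have "real (Suc n) * t - 1 \<le> of_int \<lfloor>real (Suc n) * t\<rfloor>"
        by linarith
      then have "(real (Suc n) * t - 1) / real (Suc n) \<le> of_int \<lfloor>real (Suc n) * t\<rfloor> / real (Suc n)"
        by (intro divide_right_mono) auto
      then show "t - 1 / real (Suc n) \<le> of_int \<lfloor>real (Suc n) * t\<rfloor> / real (Suc n)"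
        by (simp add: diff_divide_distrib)
    qed
    show "\<forall>\<^sub>F n in sequentially. of_int \<lfloor>real (Suc n) * t\<rfloor> / real (Suc n) \<le> t"
    proof (intro always_eventually allI)
      fix n
      have "of_int \<lfloor>real (Suc n) * t\<rfloor> \<le> real (Suc n) * t"
        by linarith
      then show "of_int \<lfloor>real (Suc n) * t\<rfloor> / real (Suc n) \<le> t"
        by (subst pos_divide_le_eq) (auto simp: mult.commute)
    qed
    have "(\<lambda>n. t - inverse (real (Suc n))) \<longlonglongrightarrow> t - 0"
      by (intro tendsto_intros LIMSEQ_inverse_real_of_nat)
    then show "(\<lambda>n. t - 1 / real (Suc n)) \<longlonglongrightarrow> t"
      by (simp add: inverse_eq_divide)
  qed simp
  then have "(\<lambda>n. c (of_int \<lfloor>real (Suc n) * t\<rfloor> / real (Suc n))) \<longlonglongrightarrow> c t"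
    by (rule continuous_on_tendsto_compose[OF c]) auto
  then show "(\<lambda>n. dist (c (of_int \<lfloor>real (Suc n) * t\<rfloor> / real (Suc n))) (f t)) \<longlonglongrightarrow> dist (c t) (f t)"
    by (intro tendsto_intros)
qed

text \<open>Admissibility and observability are stated with Bochner integrals, Fatou's lemma needs
  nonnegative integrals and translations are easiest for Henstock--Kurzweil integrals; for
  continuous integrands all three agree.\<close>

lemma nn_integral_continuous:
  fixes g :: "real \<Rightarrow> real"
  assumes "continuous_on UNIV g" "\<And>t. 0 \<le> g t"
  shows "(\<integral>\<^sup>+t\<in>{a..b}. ennreal (g t) \<partial>lebesgue) = ennreal (LINT t:{a..b}|lebesgue. g t)"
    and "(LINT t:{a..b}|lebesgue. g t) = integral {a..b} g"
proof -
  have int: "set_integrable lebesgue {a..b} g"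
    by (intro absolutely_integrable_continuous_real continuous_on_subset[OF assms(1)]) auto
  then show "(LINT t:{a..b}|lebesgue. g t) = integral {a..b} g"
    by (rule set_lebesgue_integral_eq_integral)
  have "(\<integral>\<^sup>+t\<in>{a..b}. ennreal (g t) \<partial>lebesgue) = (\<integral>\<^sup>+t. ennreal (indicator {a..b} t *\<^sub>R g t) \<partial>lebesgue)"
    by (intro nn_integral_cong) (simp add: indicator_def)
  also have "\<dots> = ennreal (LINT t:{a..b}|lebesgue. g t)"
    using int assms(2) unfolding set_integrable_def set_lebesgue_integral_def
    by (intro nn_integral_eq_integral) auto
  finally show "(\<integral>\<^sup>+t\<in>{a..b}. ennreal (g t) \<partial>lebesgue) = ennreal (LINT t:{a..b}|lebesgue. g t)" .
qed

lemma AE_lebesgue_if_bounded: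
  assumes "\<And>r. r > 0 \<Longrightarrow> AE t in lebesgue. t \<in> {-r..r} \<longrightarrow> P t"
  shows "AE t in lebesgue. P (t::real)"
proof -
  have "AE t in lebesgue. \<forall>n. t \<in> {- real (Suc n)..real (Suc n)} \<longrightarrow> P t"
    unfolding AE_all_countable by (intro allI assms) auto
  then show ?thesis
  proof eventually_elim
    case (elim t)
    obtain n where "\<bar>t\<bar> \<le> real n"
      using real_arch_simple by blast
    then have "t \<in> {- real (Suc n)..real (Suc n)}"
      by (auto simp: abs_le_iff)
    with elim show ?case by blast
  qed
qed

locale observation_setting = adjoint_setting \<S> for \<S> :: "('k::real_or_complex, 'h::{real_inner,banach}, 'hd::{real_inner,banach},
                'u::{real_inner,banach}, 'ud::{real_inner,banach}) control_system" +
  assumes admissible: "\<forall>\<tau>>0. \<exists>c\<^sub>1>0. \<forall>x\<in>domAst \<S>.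
      (LINT t:{0..\<tau>}|lebesgue. (norm (opBst \<S> (expAst \<S> (- t) x)))\<^sup>2) \<le> c\<^sub>1 * (norm x)\<^sup>2"
begin

definition energy :: "real \<Rightarrow> (real \<Rightarrow> 'ud) \<Rightarrow> ennreal" where
  "energy r f = (\<integral>\<^sup>+t\<in>{-r..r}. ennreal ((norm (f t))\<^sup>2) \<partial>lebesgue)"

lemma continuous_norm_outp: "y \<in> D \<Longrightarrow> continuous_on UNIV (\<lambda>t. (norm (outp y t))\<^sup>2)"
  by (intro continuous_intros continuous_outp)

lemma measurable_energy_density:
  assumes "y \<in> D"
  shows "(\<lambda>t. ennreal ((norm (outp y t))\<^sup>2) * indicator {-r..r} t) \<in> borel_measurable lebesgue"
  by (intro borel_measurable_times_ennreal borel_measurable_indicator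
      measurable_compose[OF borel_measurable_lebesgue_continuous measurable_ennreal]
      continuous_norm_outp assms) auto

lemma energy_outp_bound:
  assumes "r > 0"
  obtains c where "c > 0" "\<And>y. y \<in> D \<Longrightarrow> energy r (outp y) \<le> ennreal (c * (norm y)\<^sup>2)"
proof -
  obtain c where c: "c > 0" "\<And>y. y \<in> D \<Longrightarrow>
      (LINT t:{0..2*r}|lebesgue. (norm (outp y t))\<^sup>2) \<le> c * (norm y)\<^sup>2"
    using admissible[rule_format, of "2 * r"] assms unfolding outp_def by auto
  obtain M where M: "0 \<le> M" "\<And>t y. \<bar>t\<bar> \<le> r \<Longrightarrow> norm (Tst t y) \<le> M * norm y"
    using expAst_locally_bounded by metis
  show thesis
  proof (rule that)
    show "c * (M\<^sup>2 + 1) > 0"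
      using c(1) by (simp add: add_nonneg_pos)
    fix y assume y: "y \<in> D"
    \<comment> \<open>Observing \<open>y\<close> on \<open>{-r..r}\<close> amounts to observing its state at time \<open>-r\<close> on \<open>{0..2*r}\<close>.\<close>
    define z where "z = Tst r y"
    have z: "z \<in> D"
      unfolding z_def by (rule expAst_domAst[OF y])
    have "integral {-r..r} (\<lambda>t. (norm (outp y t))\<^sup>2)
        = integral {-r..r} ((\<lambda>t. (norm (outp z t))\<^sup>2) \<circ> ((+) r))"
      using outp_shift[of "-r" y] by (simp add: z_def o_def)
    also have "\<dots> = integral {0..2*r} (\<lambda>t. (norm (outp z t))\<^sup>2)"
      by (subst integral_shift_Icc_real) simp
    also have "\<dots> \<le> c * (norm z)\<^sup>2"
      using c(2)[OF z] by (simp add: nn_integral_continuous continuous_norm_outp z)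
    also have "\<dots> \<le> c * (M * norm y)\<^sup>2"
      unfolding z_def using c(1) assms by (intro mult_left_mono power_mono M) auto
    also have "\<dots> \<le> c * (M\<^sup>2 + 1) * (norm y)\<^sup>2"
      using c(1) by (simp add: power_mult_distrib algebra_simps)
    finally show "energy r (outp y) \<le> ennreal (c * (M\<^sup>2 + 1) * (norm y)\<^sup>2)"
      unfolding energy_def
      by (simp add: nn_integral_continuous continuous_norm_outp y ennreal_leI)
  qed
qed

text \<open>Fatou's lemma extends the admissibility estimate to almost everywhere limits of outputs.\<close>

lemma energy_limit_bound:
  assumes Y: "\<And>n. Y n \<in> D" "Y \<longlonglongrightarrow> x" and f: "AE t in lebesgue. (\<lambda>n. outp (Y n) t) \<longlonglongrightarrow> f t"
    and z: "z \<in> D" and c: "\<And>y. y \<in> D \<Longrightarrow> energy r (outp y) \<le> ennreal (c * (norm y)\<^sup>2)"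
  shows "energy r (\<lambda>t. outp z t - f t) \<le> ennreal (c * (norm (z - x))\<^sup>2)"
proof -
  let ?u = "\<lambda>n t. ennreal ((norm (outp (z - Y n) t))\<^sup>2) * indicator {-r..r} t"
  have "energy r (\<lambda>t. outp z t - f t) = (\<integral>\<^sup>+t. liminf (\<lambda>n. ?u n t) \<partial>lebesgue)"
    unfolding energy_def
  proof (rule nn_integral_cong_AE)
    show "AE t in lebesgue. ennreal ((norm (outp z t - f t))\<^sup>2) * indicator {- r..r} t
        = liminf (\<lambda>n. ?u n t)"
      using f
    proof eventually_elim
      case (elim t)
      have "(\<lambda>n. (norm (outp (z - Y n) t))\<^sup>2) \<longlonglongrightarrow> (norm (outp z t - f t))\<^sup>2"
        using elim by (simp only: outp_diff[OF z Y(1)]) (intro tendsto_intros)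
      then have "(\<lambda>n. ?u n t) \<longlonglongrightarrow> ennreal ((norm (outp z t - f t))\<^sup>2) * indicator {- r..r} t"
        by (auto simp: indicator_def intro: tendsto_ennrealI)
      then show ?case
        by (simp add: lim_imp_Liminf)
    qed
  qed
  also have "\<dots> \<le> liminf (\<lambda>n. energy r (outp (z - Y n)))"
    unfolding energy_def
    by (intro nn_integral_liminf measurable_energy_density domAst_diff z Y)
  also have "\<dots> \<le> liminf (\<lambda>n. ennreal (c * (norm (z - Y n))\<^sup>2))"
    by (intro Liminf_mono always_eventually allI c domAst_diff z Y)
  also have "\<dots> = ennreal (c * (norm (z - x))\<^sup>2)"
    by (intro lim_imp_Liminf tendsto_ennrealI tendsto_intros Y) simp
  finally show ?thesis .
qed

text \<open>The completeness argument: an almost everywhere limit along one approximating sequence is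
  automatically the \<open>L\<^sup>2\<close> limit along every such sequence.\<close>

lemma is_observation_if_limit:
  assumes Y: "\<And>n. Y n \<in> D" "Y \<longlonglongrightarrow> x" and f: "AE t in lebesgue. (\<lambda>n. outp (Y n) t) \<longlonglongrightarrow> f t"
  shows "is_observation \<S> x f"
  unfolding is_observation_def
proof (intro conjI allI impI)
  show "f \<in> borel_measurable lebesgue"
    by (rule borel_measurable_lebesgue_AE_limit[OF _ f])
      (intro borel_measurable_lebesgue_continuous continuous_outp Y)
next
  fix r :: real assume "r > 0"
  then obtain c where c: "\<And>y. y \<in> D \<Longrightarrow> energy r (outp y) \<le> ennreal (c * (norm y)\<^sup>2)"
    using energy_outp_bound by metis
  have "outp 0 t = 0" for t
    using outp_diff[OF domAst_0 domAst_0] by simp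
  then have "energy r f = energy r (\<lambda>t. outp 0 t - f t)"
    by (simp add: energy_def)
  also have "\<dots> \<le> ennreal (c * (norm (0 - x))\<^sup>2)"
    by (rule energy_limit_bound[OF Y f domAst_0 c])
  also have "\<dots> < \<infinity>"
    by simp
  finally show "(\<integral>\<^sup>+t\<in>{-r..r}. ennreal ((norm (f t))\<^sup>2) \<partial>lebesgue) < \<infinity>"
    by (simp add: energy_def)
next
  fix X and r :: real assume X: "(\<forall>n. X n \<in> D) \<and> X \<longlonglongrightarrow> x" and "r > 0"
  then obtain c where c: "\<And>y. y \<in> D \<Longrightarrow> energy r (outp y) \<le> ennreal (c * (norm y)\<^sup>2)"
    using energy_outp_bound by metis
  have "(\<lambda>n. ennreal (c * (norm (X n - x))\<^sup>2)) \<longlonglongrightarrow> ennreal (c * (norm (x - x))\<^sup>2)"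
    using X by (intro tendsto_ennrealI tendsto_intros) auto
  then have "(\<lambda>n. ennreal (c * (norm (X n - x))\<^sup>2)) \<longlonglongrightarrow> 0"
    by simp
  note upper = this
  have le: "energy r (\<lambda>t. outp (X n) t - f t) \<le> ennreal (c * (norm (X n - x))\<^sup>2)" for n
    using X by (intro energy_limit_bound[OF Y f _ c]) auto
  have "(\<lambda>n. energy r (\<lambda>t. outp (X n) t - f t)) \<longlonglongrightarrow> 0"
    by (rule tendsto_sandwich[OF _ _ tendsto_const upper])
      (simp_all add: le always_eventually)
  then show "(\<lambda>n. \<integral>\<^sup>+t\<in>{-r..r}. ennreal ((norm (Bst (Tst (- t) (X n)) - f t))\<^sup>2) \<partial>lebesgue)
      \<longlonglongrightarrow> 0"
    unfolding energy_def outp_def .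
qed

text \<open>Along a sequence converging geometrically to \<open>x\<close> the outputs converge almost everywhere,
  because the weighted sum of the squares of their increments has a finite integral.\<close>

lemma outp_AE_convergent_sequence:
  obtains Y f where "\<And>n. Y n \<in> D" "Y \<longlonglongrightarrow> x" "AE t in lebesgue. (\<lambda>n. outp (Y n) t) \<longlonglongrightarrow> f t"
proof -
  have "\<exists>y\<in>D. dist y x < (1/4) ^ n" for n :: nat
    using domAst_dense closure_approachable[of x D] by auto
  then obtain Y where Y: "\<And>n. Y n \<in> D" "\<And>n. dist (Y n) x < (1/4) ^ n"
    by metis
  have "Y \<longlonglongrightarrow> x"
  proof (rule metric_tendsto_imp_tendsto[of "\<lambda>n. (1/4) ^ n :: real" 0])
    show "\<forall>\<^sub>F n in sequentially. dist (Y n) x \<le> dist ((1/4) ^ n :: real) 0"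
      using Y(2) by (auto simp: less_imp_le)
  qed (simp add: LIMSEQ_power_zero)
  define d where "d n t = outp (Y (Suc n)) t - outp (Y n) t" for n t
  have d: "d n t = outp (Y (Suc n) - Y n) t" for n t
    by (simp add: d_def outp_diff Y)
  have "AE t in lebesgue. convergent (\<lambda>n. outp (Y n) t)"
  proof (rule AE_lebesgue_if_bounded)
    fix r :: real assume "r > 0"
    then obtain c where c: "c > 0" "\<And>y. y \<in> D \<Longrightarrow> energy r (outp y) \<le> ennreal (c * (norm y)\<^sup>2)"
      using energy_outp_bound by metis
    \<comment> \<open>The energies of the increments decay like \<open>(1/16) ^ n\<close>, which leaves room for the factor \<open>4 ^ n\<close>;
      this factor makes the increments themselves, and not only their squares, summable pointwise.\<close>
    let ?u = "\<lambda>n t. ennreal (4 ^ n) * (ennreal ((norm (d n t))\<^sup>2) * indicator {-r..r} t)"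
    have meas: "?u n \<in> borel_measurable lebesgue" for n
      unfolding d
      by (intro borel_measurable_times_ennreal measurable_energy_density domAst_diff Y) simp
    have bound: "(\<integral>\<^sup>+t. ?u n t \<partial>lebesgue) \<le> ennreal (c * 4 * (1/4) ^ n)" for n
    proof -
      have "(\<integral>\<^sup>+t. ?u n t \<partial>lebesgue) = ennreal (4 ^ n) * energy r (outp (Y (Suc n) - Y n))"
        unfolding energy_def d
        by (intro nn_integral_cmult measurable_energy_density domAst_diff Y)
      also have "\<dots> \<le> ennreal (4 ^ n) * ennreal (c * (norm (Y (Suc n) - Y n))\<^sup>2)"
        by (intro mult_left_mono c domAst_diff Y) auto
      also have "\<dots> = ennreal (4 ^ n * (c * (norm (Y (Suc n) - Y n))\<^sup>2))"
        using c(1) by (intro ennreal_mult[symmetric]) auto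
      also have "\<dots> \<le> ennreal (c * 4 * (1/4) ^ n)"
      proof (rule ennreal_leI)
        have "norm (Y (Suc n) - Y n) \<le> dist (Y (Suc n)) x + dist (Y n) x"
          by (metis dist_norm dist_triangle2)
        also have "\<dots> \<le> 2 * (1/4) ^ n"
          using Y(2)[of "Suc n"] Y(2)[of n] zero_le_power[of "1/4::real" n]
          unfolding power_Suc by linarith
        finally have "(norm (Y (Suc n) - Y n))\<^sup>2 \<le> (2 * (1/4) ^ n)\<^sup>2"
          by (intro power_mono) auto
        also have "\<dots> = 4 * ((1/4) ^ n * (1/4) ^ n)"
          by (simp add: power2_eq_square)
        finally have "4 ^ n * (c * (norm (Y (Suc n) - Y n))\<^sup>2) \<le> 4 ^ n * (c * (4 * ((1/4) ^ n * (1/4) ^ n)))"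
          using c(1) by (intro mult_left_mono) auto
        also have "\<dots> = c * 4 * (1/4) ^ n"
          by (simp add: power_divide)
        finally show "4 ^ n * (c * (norm (Y (Suc n) - Y n))\<^sup>2) \<le> c * 4 * (1/4) ^ n" .
      qed
      finally show ?thesis .
    qed
    have "(\<integral>\<^sup>+t. (\<Sum>n. ?u n t) \<partial>lebesgue) = (\<Sum>n. \<integral>\<^sup>+t. ?u n t \<partial>lebesgue)"
      by (rule nn_integral_suminf[OF meas])
    also have "\<dots> \<le> (\<Sum>n. ennreal (c * 4 * (1/4) ^ n))"
      by (intro suminf_le bound) auto
    also have "\<dots> < \<infinity>"
    proof -
      have "summable (\<lambda>n. c * 4 * (1/4) ^ n)"
        by (intro summable_mult summable_geometric) simp
      then have "(\<Sum>n. ennreal (c * 4 * (1/4) ^ n)) \<noteq> top"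
        using c(1) by (intro ennreal_suminf_neq_top) auto
      then show ?thesis
        unfolding infinity_ennreal_def less_top .
    qed
    finally have "AE t in lebesgue. (\<Sum>n. ?u n t) \<noteq> \<infinity>"
      by (intro nn_integral_PInf_AE borel_measurable_suminf_order meas) auto
    then show "AE t in lebesgue. t \<in> {-r..r} \<longrightarrow> convergent (\<lambda>n. outp (Y n) t)"
    proof eventually_elim
      case (elim t)
      show ?case
      proof
        assume t: "t \<in> {-r..r}"
        obtain s where s: "s \<ge> 0" "(\<Sum>n. ?u n t) = ennreal s"
          using elim by (cases "\<Sum>n. ?u n t") auto
        have d_le: "norm (d n t) \<le> sqrt s * (1/2) ^ n" for n
        proof -
          have "?u n t \<le> ennreal s"
            unfolding s(2)[symmetric] using sum_le_suminf[of "\<lambda>n. ?u n t" "{n}"] by auto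
          then have "4 ^ n * (norm (d n t))\<^sup>2 \<le> s"
            using t s(1) by (simp flip: ennreal_mult)
          then have "(norm (d n t))\<^sup>2 \<le> s * (1/4) ^ n"
            by (simp add: field_simps)
          also have "\<dots> = (sqrt s * (1/2) ^ n)\<^sup>2"
          proof -
            have "((1/2) ^ n)\<^sup>2 = ((1/2)\<^sup>2 :: real) ^ n"
              by (metis power_mult mult.commute)
            also have "(1/2)\<^sup>2 = (1/4 :: real)"
              by (simp add: power2_eq_square)
            finally show ?thesis
              using s(1) unfolding power_mult_distrib by simp
          qed
          finally show ?thesis
            by (rule power2_le_imp_le) (use s(1) in simp)
        qed
        have "summable (\<lambda>n. sqrt s * (1/2) ^ n)"
          by (intro summable_mult summable_geometric) simp
        then have "summable (\<lambda>n. d n t)"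
          by (rule summable_comparison_test'[where N = 0]) (rule d_le)
        then have "convergent (\<lambda>n. \<Sum>k<n. d k t)"
          by (simp add: summable_iff_convergent)
        then have "convergent (\<lambda>n. outp (Y 0) t + (\<Sum>k<n. d k t))"
          by (intro convergent_add convergent_const)
        moreover have "outp (Y 0) t + (\<Sum>k<n. d k t) = outp (Y n) t" for n
          using sum_lessThan_telescope[of "\<lambda>k. outp (Y k) t" n] unfolding d_def by simp
        ultimately show "convergent (\<lambda>n. outp (Y n) t)"
          by simp
      qed
    qed
  qed
  then have "AE t in lebesgue. (\<lambda>n. outp (Y n) t) \<longlonglongrightarrow> lim (\<lambda>n. outp (Y n) t)"
    by eventually_elim (simp add: convergent_LIMSEQ_iff)
  with Y(1) \<open>Y \<longlonglongrightarrow> x\<close> show thesis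
    by (rule that)
qed

text \<open>Fatou's lemma bounds the local \<open>L\<^sup>2\<close> norm of \<open>g - f\<close> by the limit inferior of those of
  \<open>outp (Y n) - f\<close>, which tend to \<open>0\<close> by the definition of an observation.\<close>

lemma is_observation_unique:
  assumes f: "is_observation \<S> x f" and Y: "\<And>n. Y n \<in> D" "Y \<longlonglongrightarrow> x"
    and g: "AE t in lebesgue. (\<lambda>n. outp (Y n) t) \<longlonglongrightarrow> g t"
  shows "AE t in lebesgue. f t = g t"
proof (rule AE_lebesgue_if_bounded)
  fix r :: real assume "r > 0"
  let ?u = "\<lambda>n t. ennreal ((norm (outp (Y n) t - f t))\<^sup>2) * indicator {-r..r} t"
  have "f \<in> borel_measurable lebesgue"
    using f by (simp add: is_observation_def)
  then have meas: "?u n \<in> borel_measurable lebesgue" for n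
    by (intro borel_measurable_times_ennreal borel_measurable_indicator
        measurable_compose[OF borel_measurable_power measurable_ennreal])
      (use borel_measurable_dist_continuous[of f "outp (Y n)"] in
        \<open>auto simp: dist_norm continuous_outp Y\<close>)
  have "(\<integral>\<^sup>+t. liminf (\<lambda>n. ?u n t) \<partial>lebesgue) \<le> liminf (\<lambda>n. \<integral>\<^sup>+t. ?u n t \<partial>lebesgue)"
    by (rule nn_integral_liminf[OF meas])
  also have "(\<lambda>n. \<integral>\<^sup>+t. ?u n t \<partial>lebesgue) \<longlonglongrightarrow> 0"
    using f Y \<open>r > 0\<close> unfolding is_observation_def outp_def by blast
  then have "liminf (\<lambda>n. \<integral>\<^sup>+t. ?u n t \<partial>lebesgue) = 0"
    by (intro lim_imp_Liminf) auto
  finally have "(\<integral>\<^sup>+t. liminf (\<lambda>n. ?u n t) \<partial>lebesgue) = 0"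
    by simp
  then have "AE t in lebesgue. liminf (\<lambda>n. ?u n t) = 0"
    by (subst (asm) nn_integral_0_iff_AE) (auto intro: borel_measurable_liminf meas)
  with g show "AE t in lebesgue. t \<in> {-r..r} \<longrightarrow> f t = g t"
  proof eventually_elim
    case (elim t)
    show ?case
    proof
      assume "t \<in> {-r..r}"
      have "(\<lambda>n. (norm (outp (Y n) t - f t))\<^sup>2) \<longlonglongrightarrow> (norm (g t - f t))\<^sup>2"
        by (intro tendsto_intros elim)
      then have "(\<lambda>n. ?u n t) \<longlonglongrightarrow> ennreal ((norm (g t - f t))\<^sup>2)"
        using \<open>t \<in> {-r..r}\<close> by (auto intro: tendsto_ennrealI)
      then have "ennreal ((norm (g t - f t))\<^sup>2) = 0"
        using elim by (metis lim_imp_Liminf trivial_limit_sequentially)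
      then show "f t = g t"
        by simp
    qed
  qed
qed

abbreviation "obs \<equiv> observation \<S>"

lemma is_observation_observation: "is_observation \<S> x (obs x)"
proof -
  obtain Y f where "\<And>n. Y n \<in> D" "Y \<longlonglongrightarrow> x" "AE t in lebesgue. (\<lambda>n. outp (Y n) t) \<longlonglongrightarrow> f t"
    by (rule outp_AE_convergent_sequence[of x]) blast
  then have "is_observation \<S> x f"
    by (rule is_observation_if_limit)
  then show ?thesis
    unfolding observation_def by (rule someI[of "is_observation \<S> x"])
qed

text \<open>Whatever representative \<open>observation\<close> has chosen, it is an almost everywhere limit of outputs
  along some sequence. All properties of the observation are derived from this.\<close>

lemma observation_AE_limit:
  obtains Y where "\<And>n. Y n \<in> D" "Y \<longlonglongrightarrow> x" "AE t in lebesgue. (\<lambda>n. outp (Y n) t) \<longlonglongrightarrow> obs x t"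
proof -
  obtain Y f where Y: "\<And>n. Y n \<in> D" "Y \<longlonglongrightarrow> x" and f: "AE t in lebesgue. (\<lambda>n. outp (Y n) t) \<longlonglongrightarrow> f t"
    by (rule outp_AE_convergent_sequence[of x]) blast
  have "AE t in lebesgue. (\<lambda>n. outp (Y n) t) \<longlonglongrightarrow> obs x t"
    using is_observation_unique[OF is_observation_observation Y f] f
    by eventually_elim simp
  with Y show thesis
    by (rule that)
qed

lemma observation_AE_eq:
  assumes "\<And>n. Y n \<in> D" "Y \<longlonglongrightarrow> x" "AE t in lebesgue. (\<lambda>n. outp (Y n) t) \<longlonglongrightarrow> g t"
  shows "AE t in lebesgue. obs x t = g t"
  using is_observation_unique[OF is_observation_observation assms] .

lemma observation_domAst: "y \<in> D \<Longrightarrow> AE t in lebesgue. obs y t = outp y t"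
  by (rule observation_AE_eq[of "\<lambda>_. y"]) auto

lemma observation_add: "AE t in lebesgue. obs (x + y) t = obs x t + obs y t"
proof -
  obtain X where X: "\<And>n. X n \<in> D" "X \<longlonglongrightarrow> x" "AE t in lebesgue. (\<lambda>n. outp (X n) t) \<longlonglongrightarrow> obs x t"
    by (rule observation_AE_limit[of x]) blast
  obtain Y where Y: "\<And>n. Y n \<in> D" "Y \<longlonglongrightarrow> y" "AE t in lebesgue. (\<lambda>n. outp (Y n) t) \<longlonglongrightarrow> obs y t"
    by (rule observation_AE_limit[of y]) blast
  show ?thesis
  proof (rule observation_AE_eq)
    show "AE t in lebesgue. (\<lambda>n. outp (X n + Y n) t) \<longlonglongrightarrow> obs x t + obs y t"
      using X(3) Y(3) by eventually_elim (simp add: outp_add X(1) Y(1) tendsto_add)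
  qed (auto intro: domAst_add X Y tendsto_add)
qed

lemma observation_scale:
  "AE t in lebesgue. obs (scl' (state \<S>) a x) t = scl' (control \<S>) a (obs x t)"
proof -
  obtain X where X: "\<And>n. X n \<in> D" "X \<longlonglongrightarrow> x" "AE t in lebesgue. (\<lambda>n. outp (X n) t) \<longlonglongrightarrow> obs x t"
    by (rule observation_AE_limit[of x]) blast
  show ?thesis
  proof (rule observation_AE_eq)
    show "AE t in lebesgue. (\<lambda>n. outp (scl' (state \<S>) a (X n)) t) \<longlonglongrightarrow> scl' (control \<S>) a (obs x t)"
      using X(3) by eventually_elim
        (simp add: outp_scale X(1) bounded_linear.tendsto[OF U.dual.bounded_linear_scale])
  qed (auto intro: domAst_scale X bounded_linear.tendsto[OF H.dual.bounded_linear_scale])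
qed

lemma energy_observation_bound:
  assumes "\<And>y. y \<in> D \<Longrightarrow> energy r (outp y) \<le> ennreal (c * (norm y)\<^sup>2)"
  shows "energy r (obs x) \<le> ennreal (c * (norm x)\<^sup>2)"
proof -
  obtain X where X: "\<And>n. X n \<in> D" "X \<longlonglongrightarrow> x" "AE t in lebesgue. (\<lambda>n. outp (X n) t) \<longlonglongrightarrow> obs x t"
    by (rule observation_AE_limit[of x]) blast
  have "outp 0 t = 0" for t
    using outp_diff[OF domAst_0 domAst_0] by simp
  then show ?thesis
    using energy_limit_bound[OF X domAst_0 assms] by (simp add: energy_def)
qed

end

section \<open>Weighted observation forms\<close>

context observation_setting
begin

definition obs_form :: "real \<Rightarrow> (real \<Rightarrow> real) \<Rightarrow> 'hd \<Rightarrow> 'hd \<Rightarrow> 'k" where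
  "obs_form \<tau> w x y = (LINT s:{0..\<tau>}|lebesgue. w s *\<^sub>R ip' (control \<S>) (obs x s) (obs y s))"

text \<open>Sums of Borel functions into a non-separable space may fail to be Borel, so measurability of
  the inner product cannot be obtained by composition; it is inherited from the continuous outputs.\<close>

lemma measurable_ip_observation:
  "(\<lambda>s. ip' (control \<S>) (obs x s) (obs y s)) \<in> borel_measurable lebesgue"
proof -
  obtain X where X: "\<And>n. X n \<in> D" "X \<longlonglongrightarrow> x" "AE t in lebesgue. (\<lambda>n. outp (X n) t) \<longlonglongrightarrow> obs x t"
    by (rule observation_AE_limit[of x]) blast
  obtain Y where Y: "\<And>n. Y n \<in> D" "Y \<longlonglongrightarrow> y" "AE t in lebesgue. (\<lambda>n. outp (Y n) t) \<longlonglongrightarrow> obs y t"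
    by (rule observation_AE_limit[of y]) blast
  show ?thesis
  proof (rule borel_measurable_lebesgue_AE_limit)
    show "(\<lambda>s. ip' (control \<S>) (outp (X n) s) (outp (Y n) s)) \<in> borel_measurable lebesgue" for n
      by (intro borel_measurable_lebesgue_continuous continuous_outp X Y
          bounded_bilinear.continuous_on[OF U.dual.bounded_bilinear_ip])
    show "AE s in lebesgue. (\<lambda>n. ip' (control \<S>) (outp (X n) s) (outp (Y n) s))
        \<longlonglongrightarrow> ip' (control \<S>) (obs x s) (obs y s)"
      using X(3) Y(3)
      by eventually_elim (rule bounded_bilinear.tendsto[OF U.dual.bounded_bilinear_ip])
  qed
qed

lemma measurable_weighted_ip:
  "continuous_on UNIV w \<Longrightarrow>
    (\<lambda>s. w s *\<^sub>R ip' (control \<S>) (obs x s) (obs y s)) \<in> borel_measurable lebesgue"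
  by (intro borel_measurable_scaleR borel_measurable_lebesgue_continuous measurable_ip_observation)

lemma obs_form_integrable_bound:
  assumes w: "continuous_on UNIV w" and \<tau>: "\<tau> > 0"
  obtains K where "K > 0"
    "\<And>x y. set_integrable lebesgue {0..\<tau>} (\<lambda>s. w s *\<^sub>R ip' (control \<S>) (obs x s) (obs y s))"
    "\<And>x y. norm (obs_form \<tau> w x y) \<le> K * ((norm x)\<^sup>2 + (norm y)\<^sup>2)"
proof -
  obtain c where c: "c > 0" "\<And>y. y \<in> D \<Longrightarrow> energy \<tau> (outp y) \<le> ennreal (c * (norm y)\<^sup>2)"
    using energy_outp_bound[OF \<tau>] by metis
  have "bounded (w ` {0..\<tau>})"
    by (intro compact_imp_bounded compact_continuous_image continuous_on_subset[OF w]) auto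
  then obtain W where W: "W > 0" "\<And>s. s \<in> {0..\<tau>} \<Longrightarrow> \<bar>w s\<bar> \<le> W"
    unfolding bounded_pos by auto
  define u where "u x s = ennreal ((norm (obs x s))\<^sup>2) * indicator {-\<tau>..\<tau>} s" for x s
  have u_meas: "u x \<in> borel_measurable lebesgue" for x
  proof -
    have "obs x \<in> borel_measurable lebesgue"
      using is_observation_observation[of x] by (simp add: is_observation_def)
    then have "(\<lambda>s. ennreal ((norm (obs x s))\<^sup>2)) \<in> borel_measurable lebesgue"
      by (rule measurable_compose)
        (intro measurable_compose[OF borel_measurable_continuous_onI measurable_ennreal] continuous_intros)
    then show ?thesis
      unfolding u_def by (intro borel_measurable_times_ennreal borel_measurable_indicator) auto
  qed
  have u_int: "(\<integral>\<^sup>+s. u x s \<partial>lebesgue) \<le> ennreal (c * (norm x)\<^sup>2)" for x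
    using energy_observation_bound[OF c(2), of x] by (simp add: energy_def u_def)
  let ?f = "\<lambda>x y s. indicator {0..\<tau>} s *\<^sub>R (w s *\<^sub>R ip' (control \<S>) (obs x s) (obs y s))"
  have ptw: "ennreal (norm (?f x y s)) \<le> ennreal (W / 2) * (u x s + u y s)" for x y s
  proof (cases "s \<in> {0..\<tau>}")
    case True
    have "norm (?f x y s) = \<bar>w s\<bar> * norm (ip' (control \<S>) (obs x s) (obs y s))"
      using True by simp
    also have "\<dots> \<le> W * (norm (obs x s) * norm (obs y s))"
      using W by (intro mult_mono W True U.dual.norm_ip_le) auto
    also have "\<dots> \<le> W * (((norm (obs x s))\<^sup>2 + (norm (obs y s))\<^sup>2) / 2)"
      using W(1) sum_squares_bound[of "norm (obs x s)" "norm (obs y s)"]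
      by (intro mult_left_mono) auto
    finally have "ennreal (norm (?f x y s))
        \<le> ennreal (W / 2 * ((norm (obs x s))\<^sup>2 + (norm (obs y s))\<^sup>2))"
      by (intro ennreal_leI) simp
    also have "\<dots> = ennreal (W / 2) * (u x s + u y s)"
      using True W(1) by (simp add: u_def flip: ennreal_mult ennreal_plus)
    finally show ?thesis .
  qed simp
  have bound: "(\<integral>\<^sup>+s. ennreal (norm (?f x y s)) \<partial>lebesgue)
      \<le> ennreal (W / 2 * c * ((norm x)\<^sup>2 + (norm y)\<^sup>2))" for x y
  proof -
    have "(\<integral>\<^sup>+s. ennreal (norm (?f x y s)) \<partial>lebesgue)
        \<le> (\<integral>\<^sup>+s. ennreal (W / 2) * (u x s + u y s) \<partial>lebesgue)"
      by (intro nn_integral_mono ptw)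
    also have "\<dots> = ennreal (W / 2) * ((\<integral>\<^sup>+s. u x s \<partial>lebesgue) + (\<integral>\<^sup>+s. u y s \<partial>lebesgue))"
      by (simp add: nn_integral_cmult nn_integral_add u_meas borel_measurable_add)
    also have "\<dots> \<le> ennreal (W / 2) * (ennreal (c * (norm x)\<^sup>2) + ennreal (c * (norm y)\<^sup>2))"
      by (intro mult_left_mono add_mono u_int) auto
    also have "\<dots> = ennreal (W / 2 * c * ((norm x)\<^sup>2 + (norm y)\<^sup>2))"
      using W(1) c(1) by (simp add: distrib_left mult.assoc flip: ennreal_mult ennreal_plus)
    finally show ?thesis .
  qed
  have int: "integrable lebesgue (?f x y)" for x y
  proof (rule integrableI_bounded)
    show "?f x y \<in> borel_measurable lebesgue"
      by (intro borel_measurable_scaleR borel_measurable_indicator measurable_weighted_ip w) auto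
    show "(\<integral>\<^sup>+s. ennreal (norm (?f x y s)) \<partial>lebesgue) < \<infinity>"
      by (rule le_less_trans[OF bound]) simp
  qed
  show thesis
  proof (rule that[of "W / 2 * c"])
    show "W / 2 * c > 0"
      using W(1) c(1) by simp
    show "set_integrable lebesgue {0..\<tau>} (\<lambda>s. w s *\<^sub>R ip' (control \<S>) (obs x s) (obs y s))" for x y
      unfolding set_integrable_def by (rule int)
    show "norm (obs_form \<tau> w x y) \<le> W / 2 * c * ((norm x)\<^sup>2 + (norm y)\<^sup>2)" for x y
    proof -
      have "ennreal (norm (obs_form \<tau> w x y)) \<le> ennreal (W / 2 * c * ((norm x)\<^sup>2 + (norm y)\<^sup>2))"
        unfolding obs_form_def set_lebesgue_integral_def
        by (rule order_trans[OF integral_norm_bound_ennreal[OF int] bound])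
      then show ?thesis
        using W(1) c(1) by (subst (asm) ennreal_le_iff) auto
    qed
  qed
qed

context
  fixes \<tau> :: real and w :: "real \<Rightarrow> real"
  assumes w: "continuous_on UNIV w" and \<tau>: "\<tau> > 0"
begin

lemma obs_form_integrable:
  "set_integrable lebesgue {0..\<tau>} (\<lambda>s. w s *\<^sub>R ip' (control \<S>) (obs x s) (obs y s))"
  using obs_form_integrable_bound[OF w \<tau>] by blast

lemma obs_form_add_left: "obs_form \<tau> w (x + x') y = obs_form \<tau> w x y + obs_form \<tau> w x' y"
proof -
  have "obs_form \<tau> w (x + x') y = (LINT s:{0..\<tau>}|lebesgue.
      w s *\<^sub>R ip' (control \<S>) (obs x s) (obs y s) + w s *\<^sub>R ip' (control \<S>) (obs x' s) (obs y s))"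
    unfolding obs_form_def
  proof (rule set_lebesgue_integral_cong_AE)
    show "AE s\<in>{0..\<tau>} in lebesgue. w s *\<^sub>R ip' (control \<S>) (obs (x + x') s) (obs y s) =
        w s *\<^sub>R ip' (control \<S>) (obs x s) (obs y s) + w s *\<^sub>R ip' (control \<S>) (obs x' s) (obs y s)"
      using observation_add[of x x']
      by eventually_elim (simp add: U.dual.ip_add_left scaleR_add_right)
  qed (auto intro!: borel_measurable_add measurable_weighted_ip w)
  then show ?thesis
    by (simp add: obs_form_def set_integral_add obs_form_integrable)
qed

lemma obs_form_scale_left: "obs_form \<tau> w (scl' (state \<S>) a x) y = a * obs_form \<tau> w x y"
proof -
  have "obs_form \<tau> w (scl' (state \<S>) a x) y
      = (LINT s:{0..\<tau>}|lebesgue. a * (w s *\<^sub>R ip' (control \<S>) (obs x s) (obs y s)))"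
    unfolding obs_form_def
  proof (rule set_lebesgue_integral_cong_AE)
    show "AE s\<in>{0..\<tau>} in lebesgue. w s *\<^sub>R ip' (control \<S>) (obs (scl' (state \<S>) a x) s) (obs y s) =
        a * (w s *\<^sub>R ip' (control \<S>) (obs x s) (obs y s))"
      using observation_scale[of a x]
      by eventually_elim (simp add: U.dual.ip_scale_left)
    show "(\<lambda>s. a * (w s *\<^sub>R ip' (control \<S>) (obs x s) (obs y s))) \<in> borel_measurable lebesgue"
      by (intro borel_measurable_times borel_measurable_const measurable_weighted_ip w)
  qed (simp_all add: measurable_weighted_ip w)
  then show ?thesis
    by (simp only: obs_form_def set_integral_mult_right)
qed

lemma bounded_linear_obs_form_integral:
  assumes "bounded_linear f"
  shows "(LINT s:{0..\<tau>}|lebesgue. f (w s *\<^sub>R ip' (control \<S>) (obs x s) (obs y s))) = f (obs_form \<tau> w x y)"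
proof -
  interpret f: bounded_linear f by fact
  show ?thesis
    using integral_bounded_linear[OF assms obs_form_integrable[unfolded set_integrable_def]]
    unfolding obs_form_def set_lebesgue_integral_def by (simp add: f.scaleR)
qed

text \<open>Hermitian symmetry, because the weight is real-valued.\<close>

lemma obs_form_commute: "obs_form \<tau> w y x = kconj (obs_form \<tau> w x y)"
proof -
  have "ip' (control \<S>) (obs y s) (obs x s) = kconj (ip' (control \<S>) (obs x s) (obs y s))" for s
    by (rule U.dual.ip_commute)
  then have "obs_form \<tau> w y x
      = (LINT s:{0..\<tau>}|lebesgue. kconj (w s *\<^sub>R ip' (control \<S>) (obs x s) (obs y s)))"
    unfolding obs_form_def
    by (simp only: linear_cmul[OF bounded_linear.linear[OF bounded_linear_kconj]])
  then show ?thesis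
    by (simp only: bounded_linear_obs_form_integral[OF bounded_linear_kconj])
qed

lemma obs_form_add_right: "obs_form \<tau> w x (y + y') = obs_form \<tau> w x y + obs_form \<tau> w x y'"
  by (metis obs_form_add_left obs_form_commute kconj_add)

lemma obs_form_scale_right: "obs_form \<tau> w x (scl' (state \<S>) a y) = kconj a * obs_form \<tau> w x y"
  by (metis obs_form_scale_left obs_form_commute kconj_mult)

text \<open>The bound by the sum of squares improves to one by the product by homogeneity.\<close>

lemma obs_form_bound:
  obtains K where "K > 0" "\<And>x y. norm (obs_form \<tau> w x y) \<le> K * norm x * norm y"
proof -
  obtain K where K: "K > 0" "\<And>x y. norm (obs_form \<tau> w x y) \<le> K * ((norm x)\<^sup>2 + (norm y)\<^sup>2)"
    using obs_form_integrable_bound[OF w \<tau>] by metis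
  have sc: "obs_form \<tau> w (a *\<^sub>R x) (b *\<^sub>R y) = (a * b) *\<^sub>R obs_form \<tau> w x y" for a b x y
    using obs_form_scale_left[of "of_real a" x] obs_form_scale_right[of _ "of_real b" y]
    by (simp add: H.dual.scale_of_real scaleR_conv_of_real)
  have "norm (obs_form \<tau> w x y) \<le> 2 * K * norm x * norm y" for x y
  proof (cases "x = 0 \<or> y = 0")
    case True
    then show ?thesis
      using sc[of 0 x 1 y] sc[of 1 x 0 y] by auto
  next
    case False
    have "obs_form \<tau> w x y
        = (norm x * norm y) *\<^sub>R obs_form \<tau> w ((1 / norm x) *\<^sub>R x) ((1 / norm y) *\<^sub>R y)"
      unfolding sc using False by simp
    then have "norm (obs_form \<tau> w x y)
        = (norm x * norm y) * norm (obs_form \<tau> w ((1 / norm x) *\<^sub>R x) ((1 / norm y) *\<^sub>R y))"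
      by simp
    also have "\<dots> \<le> (norm x * norm y) * (K * (1 + 1))"
      using K(2)[of "(1 / norm x) *\<^sub>R x" "(1 / norm y) *\<^sub>R y"] False
      by (intro mult_left_mono) auto
    finally show ?thesis
      by (simp add: mult_ac)
  qed
  then show thesis
    using K(1) by (intro that[of "2 * K"]) auto
qed

lemma bounded_bilinear_obs_form: "bounded_bilinear (obs_form \<tau> w)"
proof
  show "obs_form \<tau> w (r *\<^sub>R x) y = r *\<^sub>R obs_form \<tau> w x y" for r x y
    using obs_form_scale_left[of "of_real r" x y]
    by (simp add: H.dual.scale_of_real scaleR_conv_of_real)
  show "obs_form \<tau> w x (r *\<^sub>R y) = r *\<^sub>R obs_form \<tau> w x y" for r x y
    using obs_form_scale_right[of x "of_real r" y]
    by (simp add: H.dual.scale_of_real scaleR_conv_of_real)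
  show "\<exists>K. \<forall>x y. norm (obs_form \<tau> w x y) \<le> norm x * norm y * K"
    using obs_form_bound by (metis mult.commute mult.left_commute)
qed (rule obs_form_add_left obs_form_add_right)+

text \<open>For states in \<open>D(A\<^sup>*)\<close> the real part of the form is an integral of a continuous function, which
  gives access to the fundamental theorem of calculus.\<close>

lemma kRe_obs_form_domAst:
  assumes "x \<in> D" "y \<in> D"
  shows "kRe (obs_form \<tau> w x y) = integral {0..\<tau>} (\<lambda>s. w s * (outp x s \<bullet> outp y s))"
proof -
  let ?g = "\<lambda>s. w s * (outp x s \<bullet> outp y s)"
  have cont: "continuous_on UNIV ?g"
    by (intro continuous_intros continuous_outp assms w)
  have kRe: "kRe (r *\<^sub>R a) = r * kRe a" for r and a :: 'k
    using linear_cmul[OF bounded_linear.linear[OF bounded_linear_kRe]] by simp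
  have "kRe (obs_form \<tau> w x y)
      = (LINT s:{0..\<tau>}|lebesgue. kRe (w s *\<^sub>R ip' (control \<S>) (obs x s) (obs y s)))"
    by (rule bounded_linear_obs_form_integral[OF bounded_linear_kRe, symmetric])
  also have "\<dots> = (LINT s:{0..\<tau>}|lebesgue. ?g s)"
  proof (rule set_lebesgue_integral_cong_AE)
    show "(\<lambda>s. kRe (w s *\<^sub>R ip' (control \<S>) (obs x s) (obs y s))) \<in> borel_measurable lebesgue"
      by (intro measurable_compose[OF measurable_weighted_ip[OF w]] borel_measurable_continuous_onI
          linear_continuous_on bounded_linear_kRe)
    show "AE s\<in>{0..\<tau>} in lebesgue. kRe (w s *\<^sub>R ip' (control \<S>) (obs x s) (obs y s)) = ?g s"
      using observation_domAst[OF assms(1)] observation_domAst[OF assms(2)]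
      by eventually_elim (simp add: kRe U.dual.kRe_ip)
  qed (auto intro: borel_measurable_lebesgue_continuous cont)
  also have "\<dots> = integral {0..\<tau>} ?g"
    by (intro set_lebesgue_integral_eq_integral absolutely_integrable_continuous_real
        continuous_on_subset[OF cont]) auto
  finally show ?thesis .
qed

end

end

section \<open>Integration by parts along the adjoint group\<close>

text \<open>The derivative must not fall on \<open>g\<close>, which is merely continuous. With an antiderivative \<open>G\<close> of \<open>g\<close>,
  integration by parts turns the integral into boundary terms and the integral of \<open>w' s * G (s + h)\<close>, and these can
  be differentiated with respect to \<open>h\<close>.\<close>

lemma derivative_shifted_integral:
  fixes g w w' :: "real \<Rightarrow> real"
  assumes g: "continuous_on UNIV g" and w: "\<And>s. (w has_real_derivative w' s) (at s)"
    and w': "continuous_on UNIV w'" and \<tau>: "\<tau> > 0"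
  shows "((\<lambda>h. integral {0..\<tau>} (\<lambda>s. w s * g (s + h))) has_real_derivative
      w \<tau> * g \<tau> - w 0 * g 0 - integral {0..\<tau>} (\<lambda>s. w' s * g s)) (at 0)"
proof -
  obtain G where G: "\<And>t. \<bar>t\<bar> < \<tau> + 2 \<Longrightarrow> (G has_vector_derivative g t) (at t)"
    using continuous_antiderivative[OF g] by blast
  have G': "((\<lambda>h. G (a + h)) has_real_derivative g (a + h)) (at h)"
    if "0 \<le> a" "a \<le> \<tau>" "\<bar>h\<bar> < 1" for a h
  proof -
    have "(G has_real_derivative g (a + h)) (at (a + h))"
      using G[of "a + h"] that by (simp add: has_real_derivative_iff_has_vector_derivative)
    then show ?thesis
      using DERIV_shift[of G "g (a + h)" h a] by (simp add: add.commute)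
  qed
  have G_cont: "continuous_on {-1<..<\<tau> + 1} G"
    by (intro continuous_at_imp_continuous_on ballI has_vector_derivative_continuous[OF G])
      (use \<tau> in auto)
  have parts: "integral {0..\<tau>} (\<lambda>s. w s * g (s + h))
      = w \<tau> * G (\<tau> + h) - w 0 * G (0 + h) - integral {0..\<tau>} (\<lambda>s. w' s * G (s + h))"
    if h: "\<bar>h\<bar> < 1" for h
  proof -
    have deriv: "((\<lambda>s. w s * G (s + h)) has_vector_derivative w s * g (s + h) + w' s * G (s + h))
        (at s within {0..\<tau>})" if "s \<in> {0..\<tau>}" for s
    proof -
      have "(G has_real_derivative g (s + h)) (at (s + h))"
        using G[of "s + h"] abs_triangle_ineq[of s h] that h by (simp add: has_real_derivative_iff_has_vector_derivative)
      then have "((\<lambda>s. G (s + h)) has_real_derivative g (s + h)) (at s)"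
        by (simp add: DERIV_shift)
      then have "((\<lambda>s. w s * G (s + h)) has_real_derivative w s * g (s + h) + w' s * G (s + h)) (at s)"
        using w[of s] by (auto intro!: derivative_eq_intros)
      then show ?thesis
        by (simp add: has_real_derivative_iff_has_vector_derivative has_vector_derivative_at_within)
    qed
    have "((\<lambda>s. w s * g (s + h) + w' s * G (s + h)) has_integral
        w \<tau> * G (\<tau> + h) - w 0 * G (0 + h)) {0..\<tau>}"
      using \<tau> by (intro fundamental_theorem_of_calculus deriv) auto
    moreover have "((\<lambda>s. w' s * G (s + h)) has_integral integral {0..\<tau>} (\<lambda>s. w' s * G (s + h))) {0..\<tau>}"
    proof (intro integrable_integral integrable_continuous_real continuous_on_mult)
      show "continuous_on {0..\<tau>} (\<lambda>s. G (s + h))"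
        by (rule continuous_on_compose2[OF G_cont]) (use h in \<open>auto intro!: continuous_intros\<close>)
    qed (rule continuous_on_subset[OF w'], simp)
    ultimately have "((\<lambda>s. w s * g (s + h) + w' s * G (s + h) - w' s * G (s + h)) has_integral
        w \<tau> * G (\<tau> + h) - w 0 * G (0 + h) - integral {0..\<tau>} (\<lambda>s. w' s * G (s + h))) {0..\<tau>}"
      by (rule has_integral_diff)
    then show ?thesis
      by (simp add: integral_unique)
  qed
  have "((\<lambda>h. integral (cbox 0 \<tau>) (\<lambda>s. w' s * G (s + h))) has_real_derivative
      integral (cbox 0 \<tau>) (\<lambda>s. w' s * g (s + 0))) (at 0 within {-1<..<1})"
  proof (rule leibniz_rule_field_derivative[where fx = "\<lambda>h s. w' s * g (s + h)"])
    show "((\<lambda>h. w' s * G (s + h)) has_real_derivative w' s * g (s + h)) (at h within {-1<..<1})"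
      if "h \<in> {-1<..<1}" "s \<in> cbox 0 \<tau>" for h s
      using that by (intro DERIV_cmult has_field_derivative_at_within[OF G']) auto
    show "(\<lambda>s. w' s * G (s + h)) integrable_on cbox 0 \<tau>" if "h \<in> {-1<..<1}" for h
    proof (intro integrable_continuous continuous_on_mult)
      show "continuous_on (cbox 0 \<tau>) (\<lambda>s. G (s + h))"
        by (rule continuous_on_compose2[OF G_cont]) (use that in \<open>auto intro!: continuous_intros\<close>)
    qed (rule continuous_on_subset[OF w'], simp)
    show "continuous_on ({-1<..<1} \<times> cbox 0 \<tau>) (\<lambda>(h, s). w' s * g (s + h))"
      unfolding case_prod_beta
      by (intro continuous_intros continuous_on_compose2[OF w'] continuous_on_compose2[OF g]) auto
  qed auto
  then have "((\<lambda>h. integral {0..\<tau>} (\<lambda>s. w' s * G (s + h))) has_real_derivative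
      integral {0..\<tau>} (\<lambda>s. w' s * g s)) (at 0)"
    by (simp add: at_within_open[OF _ open_greaterThanLessThan])
  moreover have "((\<lambda>h. G (\<tau> + h)) has_real_derivative g \<tau>) (at 0)"
    "((\<lambda>h. G (0 + h)) has_real_derivative g 0) (at 0)"
    using G'[of \<tau> 0] G'[of 0 0] \<tau> by simp_all
  ultimately have "((\<lambda>h. w \<tau> * G (\<tau> + h) - w 0 * G (0 + h) - integral {0..\<tau>} (\<lambda>s. w' s * G (s + h)))
      has_real_derivative w \<tau> * g \<tau> - w 0 * g 0 - integral {0..\<tau>} (\<lambda>s. w' s * g s)) (at 0)"
    by (intro DERIV_diff DERIV_cmult)
  then show ?thesis
    by (rule has_field_derivative_transform_within_open[where S = "{-1<..<1}"])
      (use parts in \<open>auto simp: abs_less_iff\<close>)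
qed

context observation_setting
begin

text \<open>Up to sign, the real parts of both sides are the derivative at \<open>h = 0\<close> of that of the form at
  \<open>e\<^sup>-\<^sup>h\<^sup>A\<^sup>* y\<close> and \<open>e\<^sup>-\<^sup>h\<^sup>A\<^sup>* z\<close>: on the one hand by the product rule for the form, on the other hand
  because this translates the outputs by \<open>h\<close>. Differentiating the translated integral instead of
  the outputs themselves is what makes the argument work for all \<open>y\<close> and \<open>z\<close> in \<open>D(A\<^sup>*)\<close>, for which
  the outputs are merely continuous.\<close>

lemma obs_form_lyapunov:
  assumes y: "y \<in> D" and z: "z \<in> D"
    and w: "\<And>s. (w has_real_derivative w' s) (at s)" and w': "continuous_on UNIV w'" and \<tau>: "\<tau> > 0"
    and w0: "w 0 = 1" and w\<tau>: "w \<tau> = 0"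
  shows "obs_form \<tau> w (Ast y) z + obs_form \<tau> w y (Ast z)
    = ip' (control \<S>) (Bst y) (Bst z) + obs_form \<tau> w' y z"
proof -
  have wc: "continuous_on UNIV w"
    using w by (meson DERIV_isCont continuous_at_imp_continuous_on)
  interpret kRe: bounded_linear "kRe :: 'k \<Rightarrow> real"
    by (rule bounded_linear_kRe)
  have real: "kRe (obs_form \<tau> w (Ast y) z + obs_form \<tau> w y (Ast z))
    = kRe (ip' (control \<S>) (Bst y) (Bst z) + obs_form \<tau> w' y z)" if y: "y \<in> D" for y
  proof -
    let ?a = "obs_form \<tau> w"
    interpret a: bounded_bilinear ?a
      by (rule bounded_bilinear_obs_form[OF wc \<tau>])
    let ?g = "\<lambda>s. outp y s \<bullet> outp z s"
    have Tm: "((\<lambda>h. Tst (- h) v) has_derivative (\<lambda>h. h *\<^sub>R (- Ast v))) (at 0)" if "v \<in> D" for v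
    proof -
      have "(uminus has_derivative uminus) (at (0::real))"
        by (auto intro!: derivative_eq_intros)
      moreover have "((\<lambda>t. Tst t v) has_derivative (\<lambda>h. h *\<^sub>R Ast v)) (at (- 0))"
        using derivative_expAst[OF that] by (simp add: has_vector_derivative_def)
      ultimately show ?thesis
        using has_derivative_compose[of uminus uminus 0 UNIV "\<lambda>t. Tst t v" "\<lambda>h. h *\<^sub>R Ast v"] by simp
    qed
    have "((\<lambda>h. ?a (Tst (- h) y) (Tst (- h) z)) has_derivative
        (\<lambda>h. ?a (Tst (- 0) y) (h *\<^sub>R (- Ast z)) + ?a (h *\<^sub>R (- Ast y)) (Tst (- 0) z))) (at 0)"
      by (rule a.FDERIV[OF Tm[OF y] Tm[OF z]])
    then have "((\<lambda>h. kRe (?a (Tst (- h) y) (Tst (- h) z))) has_derivative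
        (\<lambda>h. kRe (?a (Tst (- 0) y) (h *\<^sub>R (- Ast z)) + ?a (h *\<^sub>R (- Ast y)) (Tst (- 0) z)))) (at 0)"
      by (rule kRe.has_derivative)
    then have "((\<lambda>h. kRe (?a (Tst (- h) y) (Tst (- h) z))) has_real_derivative
        - kRe (?a y (Ast z) + ?a (Ast y) z)) (at 0)"
      unfolding has_field_derivative_def
      by (rule has_derivative_eq_rhs)
        (simp add: fun_eq_iff expAst_zero a.minus_left a.minus_right a.scaleR_left a.scaleR_right
          kRe.add kRe.diff kRe.neg kRe.scaleR algebra_simps)
    moreover have "kRe (?a (Tst (- h) y) (Tst (- h) z)) = integral {0..\<tau>} (\<lambda>s. w s * ?g (s + h))" for h
      by (simp add: kRe_obs_form_domAst wc \<tau> expAst_domAst y z outp_shift)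
    moreover have "((\<lambda>h. integral {0..\<tau>} (\<lambda>s. w s * ?g (s + h))) has_real_derivative
      w \<tau> * ?g \<tau> - w 0 * ?g 0 - integral {0..\<tau>} (\<lambda>s. w' s * ?g s)) (at 0)"
      by (intro derivative_shifted_integral continuous_intros continuous_outp y z w w' \<tau>)
    ultimately have "- kRe (?a y (Ast z) + ?a (Ast y) z)
        = w \<tau> * ?g \<tau> - w 0 * ?g 0 - integral {0..\<tau>} (\<lambda>s. w' s * ?g s)"
      using DERIV_unique by simp
    then show ?thesis
      by (simp add: w0 w\<tau> outp_0 kRe.add kRe_obs_form_domAst[OF w' \<tau> y z] U.dual.kRe_ip)
  qed
  show ?thesis
  proof (rule eq_if_kRe_multiples)
    fix c
    show "kRe (c * (obs_form \<tau> w (Ast y) z + obs_form \<tau> w y (Ast z)))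
        = kRe (c * (ip' (control \<S>) (Bst y) (Bst z) + obs_form \<tau> w' y z))"
      using real[OF domAst_scale[OF y], of c]
      by (simp add: opAst_scale opBst_scale y obs_form_scale_left wc w' \<tau> U.dual.ip_scale_left
          distrib_left)
  qed
qed

end

section \<open>Coercive operators\<close>

text \<open>Lax--Milgram: for small \<open>r\<close> the map \<open>x \<mapsto> x - r (G x - y)\<close> is a contraction.\<close>

lemma coercive_surj:
  fixes G :: "'x::{real_inner,banach} \<Rightarrow> 'x"
  assumes G: "bounded_linear G" and c: "c > 0" and coercive: "\<And>x. c * (norm x)\<^sup>2 \<le> G x \<bullet> x"
  shows "\<exists>x. G x = y"
proof -
  interpret G: bounded_linear G by fact
  obtain K0 where K0: "\<And>x. norm (G x) \<le> norm x * K0"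
    using G.bounded by blast
  define K where "K = max K0 c"
  have K: "K > 0" "c \<le> K"
    using c by (auto simp: K_def)
  have G_le: "norm (G x) \<le> K * norm x" for x
    using K0[of x] mult_left_mono[of K0 K "norm x"] by (simp add: K_def mult.commute)
  \<comment> \<open>This \<open>r\<close> minimises the factor \<open>1 - 2 * r * c + r\<^sup>2 * K\<^sup>2\<close> of the estimate below.\<close>
  define r where "r = c / K\<^sup>2"
  have r: "r > 0" "r * K\<^sup>2 = c"
    using c K by (auto simp: r_def)
  have rc: "0 \<le> 1 - r * c" "1 - r * c < 1"
  proof -
    have "r * c = c\<^sup>2 / K\<^sup>2"
      by (simp add: r_def power2_eq_square)
    moreover have "c\<^sup>2 \<le> K\<^sup>2"
      using c K by (intro power_mono) auto
    ultimately show "0 \<le> 1 - r * c"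
      using K by simp
    show "1 - r * c < 1"
      using c r by simp
  qed
  have contraction: "norm (x - r *\<^sub>R G x) \<le> sqrt (1 - r * c) * norm x" for x
  proof (rule power2_le_imp_le)
    have "(norm (x - r *\<^sub>R G x))\<^sup>2 = (norm x)\<^sup>2 - 2 * r * (G x \<bullet> x) + r\<^sup>2 * (norm (G x))\<^sup>2"
      unfolding power2_norm_eq_inner
      by (simp add: inner_diff_left inner_diff_right inner_commute[of x "G x"] power2_eq_square[of r]
          algebra_simps)
    also have "\<dots> \<le> (norm x)\<^sup>2 - 2 * r * (c * (norm x)\<^sup>2) + r\<^sup>2 * (K * norm x)\<^sup>2"
      using r(1) G_le[of x]
      by (intro add_mono diff_mono mult_left_mono coercive power_mono) auto
    also have "r\<^sup>2 * (K * norm x)\<^sup>2 = r * (r * K\<^sup>2) * (norm x)\<^sup>2"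
      by (simp add: power2_eq_square mult_ac)
    also have "(norm x)\<^sup>2 - 2 * r * (c * (norm x)\<^sup>2) + r * (r * K\<^sup>2) * (norm x)\<^sup>2 = (1 - r * c) * (norm x)\<^sup>2"
      unfolding r(2) by (simp add: algebra_simps)
    also have "\<dots> = (sqrt (1 - r * c) * norm x)\<^sup>2"
      using rc by (simp add: power_mult_distrib)
    finally show "(norm (x - r *\<^sub>R G x))\<^sup>2 \<le> (sqrt (1 - r * c) * norm x)\<^sup>2" .
  qed (use rc in simp)
  have "\<exists>!x. x - r *\<^sub>R (G x - y) = x"
  proof (rule banach_fix_type)
    show "\<forall>x z. dist (x - r *\<^sub>R (G x - y)) (z - r *\<^sub>R (G z - y)) \<le> sqrt (1 - r * c) * dist x z"
    proof (intro allI)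
      fix x z
      have "(x - r *\<^sub>R (G x - y)) - (z - r *\<^sub>R (G z - y)) = (x - z) - r *\<^sub>R G (x - z)"
        by (simp add: G.diff algebra_simps)
      then show "dist (x - r *\<^sub>R (G x - y)) (z - r *\<^sub>R (G z - y)) \<le> sqrt (1 - r * c) * dist x z"
        using contraction[of "x - z"] by (simp only: dist_norm)
    qed
  qed (use rc in auto)
  then obtain x where "x - r *\<^sub>R (G x - y) = x"
    by blast
  then have "G x = y"
    using r(1) by simp
  then show ?thesis ..
qed

section \<open>The weight\<close>

text \<open>The two pieces of the weight agree at \<open>T\<close> together with their first derivatives; the minimum
  expresses that the slope stays constant from there on.\<close>

lemma weight_derivative:
  assumes "\<omega> > 0"
  shows "(weight \<omega> T has_real_derivative - 2 * \<omega> * exp (- 2 * \<omega> * min s T)) (at s)"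
proof -
  let ?l = "\<lambda>s. exp (- 2 * \<omega> * s)"
  let ?r = "\<lambda>s. 2 * \<omega> * exp (- 2 * \<omega> * T) * (T + 1 / (2 * \<omega>) - s)"
  have l: "(?l has_real_derivative - 2 * \<omega> * exp (- 2 * \<omega> * s)) (at s)" for s
    by (auto intro!: derivative_eq_intros)
  have r: "(?r has_real_derivative - 2 * \<omega> * exp (- 2 * \<omega> * T)) (at s)" for s
    by (auto intro!: derivative_eq_intros)
  consider "s < T" | "s > T" | "s = T"
    by linarith
  then show ?thesis
  proof cases
    case 1
    have "(weight \<omega> T has_real_derivative - 2 * \<omega> * exp (- 2 * \<omega> * s)) (at s)"
      by (rule has_field_derivative_transform_within_open[OF l, of "{..<T}"])
        (use 1 in \<open>auto simp: weight_def\<close>)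
    then show ?thesis using 1 by simp
  next
    case 2
    have "(weight \<omega> T has_real_derivative - 2 * \<omega> * exp (- 2 * \<omega> * T)) (at s)"
      by (rule has_field_derivative_transform_within_open[OF r, of "{T<..}"])
        (use 2 in \<open>auto simp: weight_def\<close>)
    then show ?thesis using 2 by simp
  next
    case 3
    have "(weight \<omega> T has_real_derivative - 2 * \<omega> * exp (- 2 * \<omega> * T)) (at_left T)"
      using has_field_derivative_at_within[OF l[of T], of "{..<T}"]
      by (subst has_field_derivative_cong_eventually[where g = ?l])
        (auto simp: weight_def eventually_at_filter)
    moreover have "(weight \<omega> T has_real_derivative - 2 * \<omega> * exp (- 2 * \<omega> * T)) (at_right T)"
      using has_field_derivative_at_within[OF r[of T], of "{T<..}"] assms
      by (subst has_field_derivative_cong_eventually[where g = ?r])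
        (auto simp: weight_def eventually_at_filter)
    ultimately show ?thesis
      using 3 unfolding has_field_derivative_iff by (simp add: filterlim_split_at)
  qed
qed

section \<open>The Gramian\<close>

locale gramian_setting = observation_setting \<S>
  for \<S> :: "('k::real_or_complex, 'h::{real_inner,banach}, 'hd::{real_inner,banach},
                'u::{real_inner,banach}, 'ud::{real_inner,banach}) control_system" +
  fixes T \<omega> :: real
  assumes T_pos: "T > 0" and \<omega>_pos: "\<omega> > 0"
    and observable: "\<exists>c\<^sub>2>0. \<forall>x\<in>domAst \<S>.
      c\<^sub>2 * (norm x)\<^sup>2 \<le> (LINT t:{0..T}|lebesgue. (norm (opBst \<S> (expAst \<S> (- t) x)))\<^sup>2)"
begin

abbreviation "\<tau> \<equiv> T + 1 / (2 * \<omega>)"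
abbreviation "gform \<equiv> obs_form \<tau> (weight \<omega> T)"
abbreviation "gform' \<equiv> obs_form \<tau> (deriv (weight \<omega> T))"
abbreviation "\<Lambda> \<equiv> gramian \<S> \<omega> T"

lemma \<tau>_pos: "\<tau> > 0"
  using T_pos \<omega>_pos by (simp add: add_pos_pos)

lemma continuous_weight: "continuous_on UNIV (weight \<omega> T)"
  using weight_derivative[OF \<omega>_pos] by (meson DERIV_isCont continuous_at_imp_continuous_on)

lemma deriv_weight: "deriv (weight \<omega> T) = (\<lambda>s. - 2 * \<omega> * exp (- 2 * \<omega> * min s T))"
  using DERIV_imp_deriv[OF weight_derivative[OF \<omega>_pos]] by (intro ext)

lemma continuous_deriv_weight: "continuous_on UNIV (deriv (weight \<omega> T))"
  unfolding deriv_weight by (intro continuous_intros)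

interpretation gform: bounded_bilinear gform
  by (rule bounded_bilinear_obs_form[OF continuous_weight \<tau>_pos])

interpretation gform': bounded_bilinear gform'
  by (rule bounded_bilinear_obs_form[OF continuous_deriv_weight \<tau>_pos])

lemmas gform_scale = obs_form_scale_left[OF continuous_weight \<tau>_pos]
  obs_form_scale_right[OF continuous_weight \<tau>_pos]
lemmas gform'_scale = obs_form_scale_left[OF continuous_deriv_weight \<tau>_pos]
  obs_form_scale_right[OF continuous_deriv_weight \<tau>_pos]
lemmas gform_commute = obs_form_commute[OF continuous_weight \<tau>_pos]
lemmas gform'_commute = obs_form_commute[OF continuous_deriv_weight \<tau>_pos]

text \<open>The weight is at least \<open>exp (- 2 * \<omega> * T)\<close> on \<open>{0..T}\<close>, where observability applies, and
  nonnegative on the rest of the interval.\<close>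

lemma gform_coercive:
  obtains c where "c > 0" "\<And>x. c * (norm x)\<^sup>2 \<le> kRe (gform x x)"
proof -
  obtain c where c: "c > 0" "\<And>x. x \<in> D \<Longrightarrow>
      c * (norm x)\<^sup>2 \<le> (LINT t:{0..T}|lebesgue. (norm (outp x t))\<^sup>2)"
    using observable unfolding outp_def by blast
  let ?c = "exp (- 2 * \<omega> * T) * c"
  have dom: "?c * (norm x)\<^sup>2 \<le> kRe (gform x x)" if x: "x \<in> D" for x
  proof -
    let ?e = "\<lambda>t. (norm (outp x t))\<^sup>2"
    have cont: "continuous_on A ?e" "continuous_on A (\<lambda>t. weight \<omega> T t * ?e t)" for A
      by (rule continuous_on_subset[of UNIV], intro continuous_intros continuous_norm_outp x
          continuous_weight, simp)+
    have "?c * (norm x)\<^sup>2 \<le> exp (- 2 * \<omega> * T) * integral {0..T} ?e"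
      using c(2)[OF x] by (simp add: nn_integral_continuous cont mult.assoc)
    also have "\<dots> = integral {0..T} (\<lambda>t. exp (- 2 * \<omega> * T) * ?e t)"
      by simp
    also have "\<dots> \<le> integral {0..T} (\<lambda>t. weight \<omega> T t * ?e t)"
      using \<omega>_pos
      by (intro integral_le integrable_continuous_real cont mult_right_mono continuous_on_mult
          continuous_on_const) (auto simp: weight_def)
    also have "\<dots> \<le> integral {0..\<tau>} (\<lambda>t. weight \<omega> T t * ?e t)"
      using \<omega>_pos
      by (intro integral_subset_le integrable_continuous_real cont) (auto simp: weight_def)
    also have "\<dots> = kRe (gform x x)"
      by (simp add: kRe_obs_form_domAst continuous_weight \<tau>_pos x power2_norm_eq_inner)
    finally show ?thesis .
  qed
  have "closed {x. ?c * (norm x)\<^sup>2 \<le> kRe (gform x x)}"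
    by (intro closed_Collect_le continuous_intros gform.continuous_on
        bounded_linear.continuous_on[OF bounded_linear_kRe])
  then have "closure D \<subseteq> {x. ?c * (norm x)\<^sup>2 \<le> kRe (gform x x)}"
    using dom by (intro closure_minimal) auto
  then show thesis
    using c(1) unfolding domAst_dense by (intro that[of ?c]) auto
qed

lemma pairing_gramian: "pr (\<Lambda> x) y = gform x y"
proof -
  obtain K where K: "\<And>x y. norm (gform x y) \<le> K * norm x * norm y"
    by (rule obs_form_bound[OF continuous_weight \<tau>_pos]) blast
  have "\<exists>!h. \<forall>y. pr h y = gform x y"
    by (rule H.antilinear_functional_representation[where K = "K * norm x"]) (use K in \<open>auto simp: gform.add_right gform_scale\<close>)
  from theI'[OF this, rule_format, of y] show ?thesis
    unfolding gramian_def obs_form_def U.pairing_riesz' .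
qed

lemma bounded_linear_gramian: "bounded_linear \<Lambda>"
proof -
  obtain K where K: "K > 0" "\<And>x y. norm (gform x y) \<le> K * norm x * norm y"
    by (rule obs_form_bound[OF continuous_weight \<tau>_pos]) blast
  show ?thesis
  proof (rule bounded_linear_intro[where K = K])
    show "\<Lambda> (x + y) = \<Lambda> x + \<Lambda> y" for x y
      by (rule H.primal_ext) (simp add: pairing_gramian H.pairing_add_left gform.add_left)
    show "\<Lambda> (r *\<^sub>R x) = r *\<^sub>R \<Lambda> x" for r x
      by (rule H.primal_ext) (simp add: pairing_gramian H.pairing_scaleR_left gform.scaleR_left)
    show "norm (\<Lambda> x) \<le> norm x * K" for x
      by (rule H.norm_primal_le) (use K in \<open>auto simp: pairing_gramian mult.commute[of K]\<close>)
  qed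
qed

text \<open>Coercivity of the form also bounds \<open>\<Lambda>\<^sup>-\<^sup>1\<close>.\<close>

lemma gramian_lower_bound:
  obtains c where "c > 0" "\<And>x. c * norm x \<le> norm (\<Lambda> x)"
proof -
  obtain c where c: "c > 0" "\<And>x. c * (norm x)\<^sup>2 \<le> kRe (gform x x)"
    by (rule gform_coercive) blast
  have "c * norm x \<le> norm (\<Lambda> x)" for x
  proof (cases "norm x = 0")
    case False
    have "c * (norm x)\<^sup>2 \<le> \<bar>kRe (pr (\<Lambda> x) x)\<bar>"
      using c(2)[of x] by (simp add: pairing_gramian)
    also have "\<dots> \<le> norm (\<Lambda> x) * norm x"
      by (rule order_trans[OF abs_kRe_le H.norm_pairing_le])
    finally have "(c * norm x) * norm x \<le> norm (\<Lambda> x) * norm x"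
      by (simp add: power2_eq_square mult.assoc)
    then show ?thesis
      using False by simp
  qed simp
  with c(1) show thesis
    by (rule that)
qed

text \<open>Composed with the Riesz map, \<open>\<Lambda>\<close> becomes a coercive operator on \<open>H'\<close>.\<close>

lemma bij_gramian: "bij \<Lambda>"
proof (rule bijI)
  interpret \<Lambda>: bounded_linear \<Lambda>
    by (rule bounded_linear_gramian)
  obtain c where c: "c > 0" "\<And>x. c * norm x \<le> norm (\<Lambda> x)"
    by (rule gramian_lower_bound) blast
  show "inj \<Lambda>"
  proof (rule injI)
    fix x y assume "\<Lambda> x = \<Lambda> y"
    then have "\<Lambda> (x - y) = 0"
      by (simp add: \<Lambda>.diff)
    then have "c * norm (x - y) \<le> 0"
      using c(2)[of "x - y"] by simp
    then show "x = y"
      using c(1) by (simp add: mult_le_0_iff)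
  qed
  obtain c' where c': "c' > 0" "\<And>x. c' * (norm x)\<^sup>2 \<le> kRe (gform x x)"
    by (rule gform_coercive) blast
  have lin: "bounded_linear (\<lambda>x. riesz (state \<S>) (\<Lambda> x))"
    by (rule bounded_linear_compose[OF H.bounded_linear_riesz bounded_linear_gramian])
  have co: "c' * (norm x)\<^sup>2 \<le> riesz (state \<S>) (\<Lambda> x) \<bullet> x" for x
    using c'(2)[of x] H.pairing_riesz'[of "riesz (state \<S>) (\<Lambda> x)" x]
    by (simp add: H.riesz'_riesz pairing_gramian flip: H.dual.kRe_ip)
  have "\<exists>x. riesz (state \<S>) (\<Lambda> x) = riesz (state \<S>) h" for h
    by (rule coercive_surj[OF lin c'(1) co])
  then have "\<exists>x. \<Lambda> x = h" for h
    by (metis H.riesz'_riesz)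
  then show "surj \<Lambda>"
    by (metis surjI)
qed

lemma inv_gramian: "inv \<Lambda> (\<Lambda> x) = x" "\<Lambda> (inv \<Lambda> h) = h"
  using bij_gramian by (simp_all add: bij_is_inj bij_is_surj surj_f_inv_f)

lemma bounded_linear_inv_gramian: "bounded_linear (inv \<Lambda>)"
proof -
  interpret \<Lambda>: bounded_linear \<Lambda>
    by (rule bounded_linear_gramian)
  obtain c where c: "c > 0" "\<And>x. c * norm x \<le> norm (\<Lambda> x)"
    by (rule gramian_lower_bound) blast
  show ?thesis
  proof (rule bounded_linear_intro[where K = "1 / c"])
    show "inv \<Lambda> (x + y) = inv \<Lambda> x + inv \<Lambda> y" for x y
      by (metis inv_gramian \<Lambda>.add)
    show "inv \<Lambda> (r *\<^sub>R x) = r *\<^sub>R inv \<Lambda> x" for r x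
      by (metis inv_gramian \<Lambda>.scaleR)
    show "norm (inv \<Lambda> h) \<le> norm h * (1 / c)" for h
      using c(1) c(2)[of "inv \<Lambda> h"] by (simp add: inv_gramian field_simps)
  qed
qed

lemma inv_gramian_scale: "inv \<Lambda> (scl (state \<S>) a h) = scl' (state \<S>) a (inv \<Lambda> h)"
proof -
  have "\<Lambda> (scl' (state \<S>) a y) = scl (state \<S>) a (\<Lambda> y)" for y
    by (rule H.primal_ext) (simp add: pairing_gramian H.pairing_scale_left gform_scale)
  then show ?thesis
    by (metis inv_gramian)
qed

lemma ip_opL: "ip (state \<S>) (opL \<S> \<omega> T x) h = - gform' (inv \<Lambda> x) (inv \<Lambda> h)"
proof -
  interpret inv: bounded_linear "inv \<Lambda>"
    by (rule bounded_linear_inv_gramian)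
  obtain K where K: "K > 0" "\<And>x y. norm (gform' x y) \<le> K * norm x * norm y"
    by (rule obs_form_bound[OF continuous_deriv_weight \<tau>_pos]) blast
  obtain M where M: "\<And>h. norm (inv \<Lambda> h) \<le> norm h * M"
    using inv.bounded by blast
  obtain z where z: "\<And>h. - gform' (inv \<Lambda> x) (inv \<Lambda> h) = ip (state \<S>) z h"
  proof (rule H.primal.riesz_representation_antilinear)
    fix h
    have "norm (gform' (inv \<Lambda> x) (inv \<Lambda> h)) \<le> K * norm (inv \<Lambda> x) * norm (inv \<Lambda> h)"
      by (rule K(2))
    also have "\<dots> \<le> K * norm (inv \<Lambda> x) * (norm h * M)"
      using K(1) by (intro mult_left_mono M) auto
    finally show "norm (- gform' (inv \<Lambda> x) (inv \<Lambda> h)) \<le> (K * norm (inv \<Lambda> x) * M) * norm h"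
      by (simp add: mult_ac)
  qed (auto simp: inv.add gform'.add_right inv_gramian_scale gform'_scale)
  have "opL \<S> \<omega> T x = z"
    unfolding opL_def U.pairing_riesz' obs_form_def[symmetric]
  proof (rule the_equality)
    fix z' assume "\<forall>y. ip (state \<S>) z' y = - gform' (inv \<Lambda> x) (inv \<Lambda> y)"
    then have "ip (state \<S>) y z' = ip (state \<S>) y z" for y
      by (metis z H.primal.ip_commute)
    then show "z' = z"
      by (rule H.primal.ip_ext)
  qed (simp add: z)
  then show ?thesis
    by (simp add: z)
qed

end

section \<open>The extension of \<open>A\<close> and the generator of the feedback group\<close>

context adjoint_setting
begin

lemma bounded_extension_A_exists: "\<exists>At. bounded_extension_A \<S> At"
proof
  let ?At = "\<lambda>x y. if y \<in> D then pr x (Ast y) else 0"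
  have le: "norm (?At x y) \<le> norm x * graph_norm \<S> y" if "y \<in> D" for x y
  proof -
    have "norm (?At x y) \<le> norm x * norm (Ast y)"
      using that by (simp add: H.norm_pairing_le)
    also have "\<dots> \<le> norm x * graph_norm \<S> y"
      by (intro mult_left_mono) (auto simp: graph_norm_def)
    finally show ?thesis .
  qed
  have antidual: "?At x \<in> antidual (scl' (state \<S>)) D (graph_norm \<S>)" for x
    unfolding antidual_def
  proof (intro CollectI conjI ballI allI impI)
    show "\<exists>K. \<forall>y\<in>D. norm (?At x y) \<le> K * graph_norm \<S> y"
      using le by blast
  qed (simp_all add: domAst_add opAst_add domAst_scale opAst_scale H.pairing_add_right
      H.pairing_scale_right)
  have norm: "antidual_norm D (graph_norm \<S>) (?At x) \<le> 1 * norm x" for x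
    unfolding antidual_norm_def
  proof (rule cSUP_least)
    have "graph_norm \<S> 0 = 0"
      by (simp add: graph_norm_def opAst_0)
    then show "{y \<in> D. graph_norm \<S> y \<le> 1} \<noteq> {}"
      using domAst_0 by (auto intro!: exI[of _ 0])
    fix y assume y: "y \<in> {y \<in> D. graph_norm \<S> y \<le> 1}"
    then have "norm (?At x y) \<le> norm x * graph_norm \<S> y"
      by (intro le) simp
    also have "\<dots> \<le> norm x"
      using y by (intro mult_left_le) auto
    finally show "norm (?At x y) \<le> 1 * norm x"
      by simp
  qed
  show "bounded_extension_A \<S> ?At"
    unfolding bounded_extension_A_def bounded_op_antidual_def
  proof (intro conjI allI ballI)
    show "\<exists>K. \<forall>x. antidual_norm D (graph_norm \<S>) (?At x) \<le> K * norm x"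
      using norm by blast
    show "?At x = embedH \<S> (opA \<S> x)" if "x \<in> domA \<S>" for x
      unfolding embedH_def using pairing_opAst that by auto
  qed (auto intro: antidual simp: fun_eq_iff H.pairing_add_left H.pairing_scale_left)
qed

text \<open>For fixed \<open>y\<close> both sides are continuous in \<open>x\<close>, and they agree on \<open>D(A)\<close>.\<close>

lemma bounded_extension_A_unique:
  assumes At: "bounded_extension_A \<S> At"
  shows "y \<in> D \<Longrightarrow> At x y = pr x (Ast y)" and "y \<notin> D \<Longrightarrow> At x y = 0"
proof -
  have op: "bounded_op_antidual (scl (state \<S>)) (scl' (state \<S>)) D (graph_norm \<S>) At"
    and ext: "\<And>x. x \<in> domA \<S> \<Longrightarrow> At x = embedH \<S> (opA \<S> x)"
    using At unfolding bounded_extension_A_def by auto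
  show "At x y = 0" if "y \<notin> D"
    using op that unfolding bounded_op_antidual_def antidual_def by blast
  assume y: "y \<in> D"
  obtain K where K: "\<And>x y. y \<in> D \<Longrightarrow> norm (At x y) \<le> K * norm x * graph_norm \<S> y"
    using bounded_op_antidual_bound[OF op] by metis
  have add: "At (u + v) = (\<lambda>y. At u y + At v y)" and scale: "At (scl (state \<S>) a u) = (\<lambda>y. a * At u y)"
    for u v a
    using op unfolding bounded_op_antidual_def by auto
  have "bounded_linear (\<lambda>x. At x y)"
  proof (rule bounded_linear_intro[where K = "K * graph_norm \<S> y"])
    show "At (u + v) y = At u y + At v y" for u v
      by (simp add: add)
    show "At (r *\<^sub>R u) y = r *\<^sub>R At u y" for r u
      using scale[of "of_real r" u] by (simp add: H.primal.scale_of_real scaleR_conv_of_real)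
    show "norm (At u y) \<le> norm u * (K * graph_norm \<S> y)" for u
      using K[OF y, of u] by (simp add: mult_ac)
  qed
  then have cont: "continuous_on UNIV (\<lambda>x. At x y)"
    by (rule linear_continuous_on)
  show "At x y = pr x (Ast y)"
  proof (rule eq_if_eq_on_dense[OF domA_dense cont])
    show "continuous_on UNIV (\<lambda>x. pr x (Ast y))"
      by (rule linear_continuous_on[OF H.pairing.bounded_linear_left])
    show "At x y = pr x (Ast y)" if "x \<in> domA \<S>" for x
      unfolding ext[OF that] embedH_def using y that by (simp add: pairing_opAst)
  qed
qed

end

text \<open>\<open>F\<close> and \<open>G\<close> are mutually inverse and continuous, so difference quotients converge on one side
  if and only if they converge on the other.\<close>

lemma conjugate_generator:
  assumes F: "bounded_linear F" and G: "bounded_linear G"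
    and FG: "\<And>x. F (G x) = x" and GF: "\<And>y. G (F y) = y"
  shows "gen_dom (\<lambda>t x. F (S t (G x))) = F ` gen_dom S"
    and "y \<in> gen_dom S \<Longrightarrow> gen (\<lambda>t x. F (S t (G x))) (F y) = F (gen S y)"
proof -
  interpret F: bounded_linear F by fact
  interpret G: bounded_linear G by fact
  have push: "((\<lambda>t. (1 / t) *\<^sub>R (F (S t (G (F y))) - F y)) \<longlongrightarrow> F z) (at 0)"
    if "((\<lambda>t. (1 / t) *\<^sub>R (S t y - y)) \<longlongrightarrow> z) (at 0)" for y z
    using F.tendsto[OF that] by (simp add: F.scaleR F.diff GF)
  have pull: "((\<lambda>t. (1 / t) *\<^sub>R (S t (G x) - G x)) \<longlongrightarrow> G z) (at 0)"
    if "((\<lambda>t. (1 / t) *\<^sub>R (F (S t (G x)) - x)) \<longlongrightarrow> z) (at 0)" for x z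
    using G.tendsto[OF that] by (simp add: G.scaleR G.diff GF)
  show "gen_dom (\<lambda>t x. F (S t (G x))) = F ` gen_dom S"
  proof (intro set_eqI iffI)
    fix x assume "x \<in> gen_dom (\<lambda>t x. F (S t (G x)))"
    then have "G x \<in> gen_dom S"
      unfolding gen_dom_def using pull by blast
    then show "x \<in> F ` gen_dom S"
      by (metis FG imageI)
  next
    fix x assume "x \<in> F ` gen_dom S"
    then show "x \<in> gen_dom (\<lambda>t x. F (S t (G x)))"
      unfolding gen_dom_def using push by blast
  qed
  assume "y \<in> gen_dom S"
  then obtain z where z: "((\<lambda>t. (1 / t) *\<^sub>R (S t y - y)) \<longlongrightarrow> z) (at 0)"
    unfolding gen_dom_def by blast
  have "gen S y = z"
    unfolding gen_def using z by (intro tendsto_Lim) auto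
  moreover have "gen (\<lambda>t x. F (S t (G x))) (F y) = F z"
    unfolding gen_def using push[OF z] by (intro tendsto_Lim) auto
  ultimately show "gen (\<lambda>t x. F (S t (G x))) (F y) = F (gen S y)"
    by simp
qed

context gramian_setting
begin

lemma weight_0: "weight \<omega> T 0 = 1"
  using T_pos by (simp add: weight_def)

lemma weight_end: "weight \<omega> T \<tau> = 0"
  using \<omega>_pos by (simp add: weight_def)

lemma gform_lyapunov:
  assumes "y \<in> D" "z \<in> D"
  shows "gform (Ast y) z + gform y (Ast z) = ip' (control \<S>) (Bst y) (Bst z) + gform' y z"
  using assms weight_derivative[OF \<omega>_pos] continuous_deriv_weight \<tau>_pos weight_0 weight_end
  by (intro obs_form_lyapunov) (auto simp: deriv_weight)

context
  fixes C :: "'h \<Rightarrow> 'h"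
  assumes C: "is_positive_sqrt (state \<S>) (opL \<S> \<omega> T) C"
begin

text \<open>The square root disappears: \<open>\<langle>h, C\<^sup>*JC\<Lambda>y\<rangle> = (Ch, C\<Lambda>y) = (C\<^sup>2h, \<Lambda>y) = (Lh, \<Lambda>y)\<close>.\<close>

lemma pairing_feedback:
  "pr h (adj pr pr C (riesz (state \<S>) (C (\<Lambda> y)))) = - gform' (inv \<Lambda> h) y"
proof -
  have "bounded_op (scl (state \<S>)) (scl (state \<S>)) C"
    using C by (simp add: is_positive_sqrt_def)
  then have "pr h (adj pr pr C (riesz (state \<S>) (C (\<Lambda> y)))) = ip (state \<S>) (C h) (C (\<Lambda> y))"
    by (simp add: adj_eq[OF H.dual_pair_space_axioms H.dual_pair_space_axioms] H.pairing_riesz)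
  also have "\<dots> = ip (state \<S>) ((C \<circ> C) h) (\<Lambda> y)"
    using C unfolding is_positive_sqrt_def comp_apply by metis
  also have "C \<circ> C = opL \<S> \<omega> T"
    using C unfolding is_positive_sqrt_def by blast
  finally show ?thesis
    by (simp add: ip_opL inv_gramian)
qed

text \<open>The Lyapunov identity, rewritten in terms of \<open>\<Lambda>\<close> and the feedback: the generator of the
  conjugated group, as a functional on \<open>D(A\<^sup>*)\<close>.\<close>

lemma pairing_gramian_gen_V:
  assumes y: "y \<in> D" and z: "z \<in> D"
  shows "pr (\<Lambda> (gen_V \<S> \<omega> T C y)) z
    = pr (\<Lambda> y) (Ast z) - opB \<S> (riesz' (control \<S>) (Bst y)) z"
proof -
  interpret gform: bounded_bilinear gform
    by (rule bounded_bilinear_obs_form[OF continuous_weight \<tau>_pos])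
  interpret kconj: bounded_linear "kconj :: 'k \<Rightarrow> 'k"
    by (rule bounded_linear_kconj)
  let ?P = "adj pr pr C (riesz (state \<S>) (C (\<Lambda> y)))"
  have "gform ?P z = kconj (pr (\<Lambda> z) ?P)"
    unfolding pairing_gramian by (rule gform_commute)
  also have "\<dots> = - kconj (gform' z y)"
    by (simp add: pairing_feedback inv_gramian kconj.neg)
  also have "\<dots> = - gform' y z"
    by (simp only: gform'_commute[of y z])
  finally have "pr (\<Lambda> (gen_V \<S> \<omega> T C y)) z = - gform (Ast y) z + gform' y z"
    by (simp add: pairing_gramian gen_V_def gform.diff_left gform.minus_left)
  also have "\<dots> = gform y (Ast z) - ip' (control \<S>) (Bst y) (Bst z)"
    using gform_lyapunov[OF y z] by (simp add: algebra_simps)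
  also have "\<dots> = pr (\<Lambda> y) (Ast z) - opB \<S> (riesz' (control \<S>) (Bst y)) z"
    by (simp add: pairing_gramian U.pairing_riesz' flip: pairing_opBst[OF z])
  finally show ?thesis .
qed

end

end

theorem theorem3p3:
  fixes \<S> :: "('k::real_or_complex, 'h::{real_inner,banach}, 'hd::{real_inner,banach},
                'u::{real_inner,banach}, 'ud::{real_inner,banach}) control_system"
    and T \<omega> :: real and C :: "'h \<Rightarrow> 'h" and V :: "real \<Rightarrow> 'hd \<Rightarrow> 'hd"
  assumes "hilbert_dual_pair (state \<S>)" and "hilbert_dual_pair (control \<S>)"
    and H1: "c0_group (scl (state \<S>)) (expA \<S>)" "generates (domA \<S>) (opA \<S>) (expA \<S>)"
    and H2: "bounded_op_antidual (scl (control \<S>)) (scl' (state \<S>)) (domAst \<S>) (graph_norm \<S>) (opB \<S>)"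
    and H3: "\<forall>\<tau>>0. \<exists>c\<^sub>1>0. \<forall>x\<in>domAst \<S>.
      (LINT t:{0..\<tau>}|lebesgue. (norm (opBst \<S> (expAst \<S> (- t) x)))\<^sup>2) \<le> c\<^sub>1 * (norm x)\<^sup>2"
    and H4: "T > 0" "\<exists>c\<^sub>2>0. \<forall>x\<in>domAst \<S>.
      c\<^sub>2 * (norm x)\<^sup>2 \<le> (LINT t:{0..T}|lebesgue. (norm (opBst \<S> (expAst \<S> (- t) x)))\<^sup>2)"
    and "\<omega> > 0"
    and C: "is_positive_sqrt (state \<S>) (opL \<S> \<omega> T) C"
    and V: "c0_group (scl' (state \<S>)) V" "generates (domAst \<S>) (gen_V \<S> \<omega> T C) V"
  shows "(\<exists>At. bounded_extension_A \<S> At) \<and>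
    gen_dom (group_U \<S> \<omega> T V) = gramian \<S> \<omega> T ` domAst \<S> \<and>
    (\<forall>At. bounded_extension_A \<S> At \<longrightarrow>
      (\<forall>x\<^sub>0 \<in> gen_dom (group_U \<S> \<omega> T V).
        (\<lambda>y. At x\<^sub>0 y
            - opB \<S> (riesz' (control \<S>) (opBst \<S> (inv (gramian \<S> \<omega> T) x\<^sub>0))) y)
        = embedH \<S> (gen (group_U \<S> \<omega> T V) x\<^sub>0)))"
proof -
  interpret V: operator_group V
    by (rule operator_group_if_c0_group[OF V(1)])
  have dom: "domAst \<S> = gen_dom V" and gen: "\<And>y. y \<in> domAst \<S> \<Longrightarrow> gen_V \<S> \<omega> T C y = gen V y"
    using V(2) unfolding generates_def by auto
  interpret gramian_setting \<S> T \<omega>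
    using assms V.gen_dom_dense by unfold_locales (simp_all add: dom)
  have U_eq: "group_U \<S> \<omega> T V = (\<lambda>t x. \<Lambda> (V t (inv \<Lambda> x)))"
    by (intro ext) (simp add: group_U_def)
  note conj = conjugate_generator[OF bounded_linear_gramian bounded_linear_inv_gramian
      inv_gramian(2) inv_gramian(1), where S = V, folded U_eq dom]
  have "(\<lambda>z. At (\<Lambda> y) z - opB \<S> (riesz' (control \<S>) (Bst (inv \<Lambda> (\<Lambda> y)))) z)
      = embedH \<S> (gen (group_U \<S> \<omega> T V) (\<Lambda> y))"
    if At: "bounded_extension_A \<S> At" and y: "y \<in> D" for At y
  proof
    fix z
    show "At (\<Lambda> y) z - opB \<S> (riesz' (control \<S>) (Bst (inv \<Lambda> (\<Lambda> y)))) z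
        = embedH \<S> (gen (group_U \<S> \<omega> T V) (\<Lambda> y)) z"
    proof (cases "z \<in> D")
      case True
      then show ?thesis
        using pairing_gramian_gen_V[OF C y True]
        by (simp add: bounded_extension_A_unique[OF At] inv_gramian embedH_def conj(2)[OF y] gen[OF y])
    next
      case False
      then show ?thesis
        by (simp add: bounded_extension_A_unique[OF At] opB_outside embedH_def)
    qed
  qed
  then show ?thesis
    using bounded_extension_A_exists conj(1) by auto
qed

end
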